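(* Let $G=SO(3)$, $H=SO(2)$ (so $G/H=\mathbb S^2$), $\lambda=m=0$ and $h=1$. Then there exists a $G$-invariant Riemannian metric $\hat g$ on $G/H$ for which there are at least two distinct $G$-invariant quasi-Einstein metrics $(g,u)$ with constant $\lambda=0$ (and $m=0$) on $G/H\times(0,1)$, with $g=dt\otimes dt+g_t$ and smoothly extendable to $G/H\times[0,1]$, satisfying the Dirichlet conditions $u(0)=0=u(1)$ and $g_0=g_1=\hat g$.
   Context: For $m\ge0$, a pair $(g,u)$ of a Riemannian metric and a smooth function is a quasi-Einstein metric with constant $\lambda$ if $Ric(g)+Hess(u)-m\,du\otimes du=\lambda g$ (so for $\lambda=m=0$: $Ric(g)+Hess(u)=0$). It is $G$-invariant if both $g$ and $u$ are, so $u=u(t)$. The metrics considered have the form $g=h^2\,dt\otimes dt+g_t$ with $h>0$ constant, $t\in(0,1)$, and $g_t$ a smooth family of $G$-invariant Riemannian metrics on $G/H$. *)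

theory Defs
  imports "HOL-Analysis.Analysis"
begin

section \<open>Smooth functions on subsets of Euclidean space\<close>

definition partial_deriv :: "'n::finite \<Rightarrow> (real^'n \<Rightarrow> real) \<Rightarrow> real^'n \<Rightarrow> real" where
  "partial_deriv i f x = frechet_derivative f (at x) (axis i 1)"

primrec Ck_on :: "nat \<Rightarrow> (real^'n::finite) set \<Rightarrow> (real^'n \<Rightarrow> real) \<Rightarrow> bool" where
  "Ck_on 0 U f \<longleftrightarrow> continuous_on U f"
| "Ck_on (Suc k) U f \<longleftrightarrow> f differentiable_on U \<and> (\<forall>i. Ck_on k U (partial_deriv i f))"

text \<open>On a set that need not be open, smooth means restriction of a smooth function on an open
  neighbourhood; in particular this is smoothness up to the boundary on a closed domain.\<close>

definition smooth_on :: "(real^'n::finite) set \<Rightarrow> (real^'n \<Rightarrow> real) \<Rightarrow> bool" where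
  "smooth_on S f \<longleftrightarrow>
     (\<exists>U F. open U \<and> S \<subseteq> U \<and> (\<forall>k. Ck_on k U F) \<and> (\<forall>x\<in>S. F x = f x))"


section \<open>Riemannian geometry in a coordinate chart\<close>

text \<open>Here \<open>G\<close> is the matrix field of a metric in coordinates. The sign of \<open>ricci\<close> is the one for
  which round spheres have positive Ricci curvature.\<close>

definition christoffel :: "(real^'n::finite \<Rightarrow> real^'n^'n) \<Rightarrow> 'n \<Rightarrow> 'n \<Rightarrow> 'n \<Rightarrow> real^'n \<Rightarrow> real" where
  "christoffel G k i j x = (1/2) * (\<Sum>l\<in>UNIV. matrix_inv (G x) $ k $ l *
     (partial_deriv i (\<lambda>y. G y $ j $ l) x + partial_deriv j (\<lambda>y. G y $ i $ l) x
      - partial_deriv l (\<lambda>y. G y $ i $ j) x))"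

definition ricci :: "(real^'n::finite \<Rightarrow> real^'n^'n) \<Rightarrow> 'n \<Rightarrow> 'n \<Rightarrow> real^'n \<Rightarrow> real" where
  "ricci G i j x =
     (\<Sum>k\<in>UNIV. partial_deriv k (christoffel G k i j) x - partial_deriv j (christoffel G k i k) x)
     + (\<Sum>k\<in>UNIV. \<Sum>l\<in>UNIV. christoffel G k k l x * christoffel G l i j x
                          - christoffel G k j l x * christoffel G l i k x)"

definition hessian ::
    "(real^'n::finite \<Rightarrow> real^'n^'n) \<Rightarrow> (real^'n \<Rightarrow> real) \<Rightarrow> 'n \<Rightarrow> 'n \<Rightarrow> real^'n \<Rightarrow> real" where
  "hessian G u i j x = partial_deriv i (partial_deriv j u) x
     - (\<Sum>k\<in>UNIV. christoffel G k i j x * partial_deriv k u x)"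


section \<open>The homogeneous space \<open>SO(3)/SO(2)\<close>\<close>

definition SO3 :: "(real^3^3) set" where
  "SO3 = {A. rotation_matrix A}"

definition SO2 :: "(real^3^3) set" where
  "SO2 = {A \<in> SO3. \<exists>c s. A = vector [vector [c, -s, 0], vector [s, c, 0], vector [0, 0, 1]]}"

definition S2 :: "(real^3) set" where
  "S2 = sphere 0 1"

definition tangent_S2 :: "real^3 \<Rightarrow> (real^3) set" where
  "tangent_S2 p = {v. v \<bullet> p = 0}"

text \<open>\<open>A SO(2) \<mapsto> A e\<^sub>3\<close> is an equivariant bijection from \<open>SO(3)/SO(2)\<close> onto the sphere, which is
  the model of \<open>G/H\<close> used below.\<close>

lemma SO3_orbit: "(\<lambda>A. A *v axis 3 1) ` SO3 = S2"
proof
  show "(\<lambda>A. A *v axis 3 1) ` SO3 \<subseteq> S2"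
  proof
    fix p :: "real^3" assume "p \<in> (\<lambda>A. A *v axis 3 1) ` SO3"
    then obtain A :: "real^3^3" where A: "orthogonal_matrix A" and p: "p = A *v axis 3 1"
      by (auto simp: SO3_def rotation_matrix_def)
    have "orthogonal_transformation ((*v) A)"
      using A by (simp add: orthogonal_transformation_matrix)
    then have "norm p = norm (axis 3 1 :: real^3)"
      unfolding p by (rule orthogonal_transformation_norm)
    then show "p \<in> S2" by (simp add: S2_def)
  qed
  show "S2 \<subseteq> (\<lambda>A. A *v axis 3 1) ` SO3"
  proof
    fix a :: "real^3" assume "a \<in> S2"
    then obtain A :: "real^3^3" where "rotation_matrix A" "A *v axis 3 1 = a"
      using rotation_matrix_exists_basis[of a 3] by (auto simp: S2_def)
    then show "a \<in> (\<lambda>A. A *v axis 3 1) ` SO3" by (auto simp: SO3_def)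
  qed
qed

lemma SO2_stabilizer: "SO2 = {A \<in> SO3. A *v axis 3 1 = axis 3 1}"
proof -
  have "\<exists>c s. A = vector [vector [c, -s, 0], vector [s, c, 0], vector [0, 0, 1]]"
    if A: "rotation_matrix A" and e: "A *v axis 3 1 = axis 3 1" for A :: "real^3^3"
  proof -
    have o: "transpose A ** A = mat 1" and d: "det A = 1"
      using A by (auto simp: rotation_matrix_def orthogonal_matrix)
    have col: "A $ 1 $ 3 = 0" "A $ 2 $ 3 = 0" "A $ 3 $ 3 = 1"
      using e by (auto simp: vec_eq_iff forall_3 matrix_vector_mult_def axis_def sum_3)
    have "transpose A *v axis 3 1 = transpose A *v (A *v axis 3 1)"
      by (simp only: e)
    also have "\<dots> = axis 3 1"
      by (simp add: matrix_vector_mul_assoc o del: transpose_matrix_vector)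
    finally have "transpose A *v axis 3 1 = axis 3 1" .
    then have row: "A $ 3 $ 1 = 0" "A $ 3 $ 2 = 0"
      by (auto simp: vec_eq_iff forall_3 matrix_vector_mult_def axis_def sum_3 transpose_def
            simp del: transpose_matrix_vector)
    define a b c d' where "a = A$1$1" "b = A$1$2" "c = A$2$1" "d' = A$2$2"
    note defs = this
    have "a\<^sup>2 + c\<^sup>2 = 1" "b\<^sup>2 + d'\<^sup>2 = 1"
      using o row
      by (auto simp: defs vec_eq_iff forall_3 matrix_matrix_mult_def sum_3 transpose_def mat_def
            power2_eq_square)
    moreover have "a * d' - b * c = 1"
      using d row col by (simp add: defs det_3)
    ultimately have "(a - d')\<^sup>2 + (b + c)\<^sup>2 = 0"
      by (simp add: power2_eq_square algebra_simps)
    then have "d' = a" "b = -c"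
      by (simp_all add: sum_power2_eq_zero_iff)
    then have "A = vector [vector [a, -c, 0], vector [c, a, 0], vector [0, 0, 1]]"
      using row col by (simp add: defs vec_eq_iff forall_3 vector_3)
    then show ?thesis by blast
  qed
  moreover have "vector [vector [c, -s, 0], vector [s, c, 0], vector [0, 0, 1]] *v (axis 3 1 :: real^3)
      = (axis 3 1 :: real^3)" for c s :: real
    by (simp add: vec_eq_iff forall_3 matrix_vector_mult_def axis_def sum_3 vector_3)
  ultimately show ?thesis
    by (auto simp: SO2_def SO3_def)
qed


section \<open>Metrics on the sphere and on its product with an interval\<close>

definition inner_product_on :: "'a::real_vector set \<Rightarrow> ('a \<Rightarrow> 'a \<Rightarrow> real) \<Rightarrow> bool" where
  "inner_product_on V b \<longleftrightarrow>
     (\<forall>v\<in>V. \<forall>w\<in>V. b v w = b w v) \<and>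
     (\<forall>v\<in>V. \<forall>v'\<in>V. \<forall>w\<in>V. b (v + v') w = b v w + b v' w) \<and>
     (\<forall>c. \<forall>v\<in>V. \<forall>w\<in>V. b (c *\<^sub>R v) w = c * b v w) \<and>
     (\<forall>v\<in>V. v \<noteq> 0 \<longrightarrow> b v v > 0)"

text \<open>Smoothness of a tensor field on the sphere is tested on its pullback under the submersion
  \<open>x \<mapsto> x / |x|\<close> (this is \<open>sgn\<close>) of the punctured space onto the sphere.\<close>

definition riemannian_metric_S2 :: "(real^3 \<Rightarrow> real^3 \<Rightarrow> real^3 \<Rightarrow> real) \<Rightarrow> bool" where
  "riemannian_metric_S2 \<gamma> \<longleftrightarrow>
     (\<forall>p\<in>S2. inner_product_on (tangent_S2 p) (\<gamma> p)) \<and>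
     (\<forall>i j. smooth_on (- {0}) (\<lambda>x. \<gamma> (sgn x)
        (frechet_derivative sgn (at x) (axis i 1)) (frechet_derivative sgn (at x) (axis j 1))))"

definition invariant_metric_S2 :: "(real^3 \<Rightarrow> real^3 \<Rightarrow> real^3 \<Rightarrow> real) \<Rightarrow> bool" where
  "invariant_metric_S2 \<gamma> \<longleftrightarrow>
     (\<forall>A\<in>SO3. \<forall>p\<in>S2. \<forall>v\<in>tangent_S2 p. \<forall>w\<in>tangent_S2 p.
        \<gamma> (A *v p) (A *v v) (A *v w) = \<gamma> p v w)"

text \<open>Fields on \<open>S2 \<times> I\<close>: a metric takes a point \<open>(p, t)\<close> and two tangent vectors \<open>(v, a)\<close>, \<open>(w, b)\<close>
  with \<open>v, w\<close> tangent to the sphere at \<open>p\<close>. Values at other arguments are irrelevant.\<close>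

type_synonym point = "(real^3) \<times> real"
type_synonym metric = "point \<Rightarrow> point \<Rightarrow> point \<Rightarrow> real"

definition tangent :: "point \<Rightarrow> point set" where
  "tangent q = tangent_S2 (fst q) \<times> UNIV"

text \<open>The global chart: a diffeomorphism from the punctured space onto \<open>S2 \<times> \<real>\<close>,
  with inverse \<open>(p, t) \<mapsto> e\<^sup>t p\<close>. The preimage of \<open>S2 \<times> I\<close> is a spherical shell.\<close>

definition chart :: "real^3 \<Rightarrow> point" where
  "chart x = (sgn x, ln (norm x))"

definition shell :: "real set \<Rightarrow> (real^3) set" where
  "shell I = {x. x \<noteq> 0 \<and> ln (norm x) \<in> I}"

lemma chart_bij: "bij_betw chart (shell I) (S2 \<times> I)"
  by (rule bij_betw_byWitness[where f' = "\<lambda>(p, t). exp t *\<^sub>R p"])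
    (auto simp: chart_def shell_def S2_def sgn_div_norm)

definition metric_in_chart :: "metric \<Rightarrow> real^3 \<Rightarrow> real^3^3" where
  "metric_in_chart g x = (\<chi> i j. g (chart x)
     (frechet_derivative chart (at x) (axis i 1)) (frechet_derivative chart (at x) (axis j 1)))"

definition smooth_function :: "real set \<Rightarrow> (point \<Rightarrow> real) \<Rightarrow> bool" where
  "smooth_function I u \<longleftrightarrow> smooth_on (shell I) (\<lambda>x. u (chart x))"

definition riemannian_metric :: "real set \<Rightarrow> metric \<Rightarrow> bool" where
  "riemannian_metric I g \<longleftrightarrow>
     (\<forall>q \<in> S2 \<times> I. inner_product_on (tangent q) (g q)) \<and>
     (\<forall>i j. smooth_on (shell I) (\<lambda>x. metric_in_chart g x $ i $ j))"

definition invariant_metric :: "real set \<Rightarrow> metric \<Rightarrow> bool" where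
  "invariant_metric I g \<longleftrightarrow>
     (\<forall>A\<in>SO3. \<forall>p\<in>S2. \<forall>t\<in>I. \<forall>(v, a) \<in> tangent (p, t). \<forall>(w, b) \<in> tangent (p, t).
        g (A *v p, t) (A *v v, a) (A *v w, b) = g (p, t) (v, a) (w, b))"

definition invariant_function :: "real set \<Rightarrow> (point \<Rightarrow> real) \<Rightarrow> bool" where
  "invariant_function I u \<longleftrightarrow> (\<forall>A\<in>SO3. \<forall>p\<in>S2. \<forall>t\<in>I. u (A *v p, t) = u (p, t))"

text \<open>The metric that \<open>g\<close> induces on the slice \<open>S2 \<times> {t}\<close>.\<close>

definition slice :: "metric \<Rightarrow> real \<Rightarrow> real^3 \<Rightarrow> real^3 \<Rightarrow> real^3 \<Rightarrow> real" where
  "slice g t p v w = g (p, t) (v, 0) (w, 0)"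

text \<open>\<open>g = h\<^sup>2 dt \<otimes> dt + g\<^sub>t\<close>.\<close>

definition normal_form :: "real \<Rightarrow> real set \<Rightarrow> metric \<Rightarrow> bool" where
  "normal_form h I g \<longleftrightarrow>
     (\<forall>p\<in>S2. \<forall>t\<in>I. \<forall>(v, a) \<in> tangent (p, t). \<forall>(w, b) \<in> tangent (p, t).
        g (p, t) (v, a) (w, b) = h\<^sup>2 * (a * b) + slice g t p v w)"

text \<open>\<open>Ric(g) + Hess(u) - m du \<otimes> du = \<lambda> g\<close> on \<open>S2 \<times> I\<close>, for \<open>I\<close> open.\<close>

definition quasi_einstein :: "real \<Rightarrow> real \<Rightarrow> real set \<Rightarrow> metric \<Rightarrow> (point \<Rightarrow> real) \<Rightarrow> bool" where
  "quasi_einstein m lam I g u \<longleftrightarrow>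
     (let G = metric_in_chart g; U = (\<lambda>x. u (chart x)) in
      \<forall>x \<in> shell I. \<forall>i j.
        ricci G i j x + hessian G U i j x - m * (partial_deriv i U x * partial_deriv j U x)
        = lam * G x $ i $ j)"

text \<open>Smooth extendability of \<open>(g, u)\<close> to \<open>S2 \<times> [0,1]\<close> is expressed by taking fields on the closed
  product that are smooth up to the boundary; the equation is imposed on the open product only.\<close>

definition dirichlet_quasi_einstein ::
    "real \<Rightarrow> real \<Rightarrow> real \<Rightarrow> (real^3 \<Rightarrow> real^3 \<Rightarrow> real^3 \<Rightarrow> real) \<Rightarrow> metric \<Rightarrow> (point \<Rightarrow> real) \<Rightarrow> bool" where
  "dirichlet_quasi_einstein m lam h \<gamma> g u \<longleftrightarrow>
     riemannian_metric {0..1} g \<and> smooth_function {0..1} u \<and>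
     invariant_metric {0..1} g \<and> invariant_function {0..1} u \<and>
     normal_form h {0..1} g \<and>
     quasi_einstein m lam {0<..<1} g u \<and>
     (\<forall>p\<in>S2. u (p, 0) = 0 \<and> u (p, 1) = 0) \<and>
     (\<forall>p\<in>S2. \<forall>v\<in>tangent_S2 p. \<forall>w\<in>tangent_S2 p.
        slice g 0 p v w = \<gamma> p v w \<and> slice g 1 p v w = \<gamma> p v w)"

definition same_pair ::
    "real set \<Rightarrow> metric \<times> (point \<Rightarrow> real) \<Rightarrow> metric \<times> (point \<Rightarrow> real) \<Rightarrow> bool" where
  "same_pair I = (\<lambda>(g1, u1) (g2, u2). \<forall>q \<in> S2 \<times> I.
     u1 q = u2 q \<and> (\<forall>v\<in>tangent q. \<forall>w\<in>tangent q. g1 q v w = g2 q v w))"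

end

theory Submission
  imports Defs "HOL-Real_Asymp.Real_Asymp"
begin

text \<open>
  For \<open>g = dt\<^sup>2 + f(t)\<^sup>2 g\<^bsub>S2\<^esub>\<close> and \<open>u = u(t)\<close> the equation \<open>Ric + Hess u = 0\<close> reads
  \<open>u'' = 2 f''/f\<close>, \<open>1 - f'\<^sup>2 - f f'' + f f' u' = 0\<close>. With \<open>y = f'\<close> and \<open>z = f u'\<close> this becomes
  \<open>f' = y\<close>, \<open>y' = (1 - y\<^sup>2 + y z)/f\<close>, \<open>z' = (2 - 2 y\<^sup>2 + 3 y z)/f\<close>. Let \<open>F\<close> be the solution with
  \<open>F(0) = 1\<close>, \<open>y(0) = z(0) = 0\<close>; it is even. Rescaling its restriction to \<open>[-x, x]\<close> to an interval of
  length 1 gives a solution of the Dirichlet problem with boundary radius \<open>F(x)/(2x)\<close>. This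
  quantity is large for small \<open>x\<close> and again when \<open>y\<close> is large, and it is smaller in between, so
  the radius 3 is attained for two different \<open>x\<close>.

  The slope \<open>y\<close> is a good parameter along the solution: \<open>dz/dy = 2 + y z/D\<close>,
  \<open>d(ln F)/dy = y/D\<close>, \<open>dx/dy = F/D\<close> with \<open>D = 1 - y\<^sup>2 + y z\<close>, and \<open>2 y\<^sup>2 \<le> y z \<le> 4 y\<^sup>2\<close> gives all
  the bounds. The scalar equation for \<open>z\<close> is solved by writing \<open>z = y s(y\<^sup>2)\<close>, which turns it into
  a fixed point equation for \<open>s\<close> that contracts in the supremum norm.
\<close>

section \<open>The rotationally symmetric steady soliton\<close>

text \<open>Banach's theorem for bounded continuous functions in the supremum norm: averaging over
  \<open>\<theta>\<close> in [0,1] keeps the Lipschitz factor \<open>q\<close>, and the bound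
  \<open>B\<close> keeps the image bounded. The argument \<open>\<theta>^2 * w\<close> comes from
  scaling \<open>y\<close> to \<open>\<theta> * y\<close> in \<open>w = y^2\<close>.\<close>

lemma averaging_fixed_point:
  fixes \<Phi> :: "real \<Rightarrow> real \<Rightarrow> real"
  assumes cont: "continuous_on UNIV (\<lambda>(w, s). \<Phi> w s)"
    and bound: "\<And>w s. \<bar>\<Phi> w s\<bar> \<le> B"
    and lip: "\<And>w s s'. \<bar>\<Phi> w s - \<Phi> w s'\<bar> \<le> q * \<bar>s - s'\<bar>"
    and q: "0 \<le> q" "q < 1"
  obtains s where "continuous_on UNIV s"
    "\<And>w. s w = integral {0..1} (\<lambda>\<theta>. \<Phi> (\<theta>\<^sup>2 * w) (s (\<theta>\<^sup>2 * w)))"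
proof -
  define T :: "(real \<Rightarrow>\<^sub>C real) \<Rightarrow> real \<Rightarrow> real"
    where "T s w = integral {0..1} (\<lambda>\<theta>. \<Phi> (\<theta>\<^sup>2 * w) (s (\<theta>\<^sup>2 * w)))" for s w
  have cont_pair: "continuous_on UNIV (\<lambda>(w, \<theta>). \<Phi> (\<theta>\<^sup>2 * w) (s (\<theta>\<^sup>2 * w)))"
    for s :: "real \<Rightarrow>\<^sub>C real"
  proof -
    have "continuous_on UNIV (\<lambda>p. s ((snd p)\<^sup>2 * fst p :: real))"
      by (rule continuous_on_compose2[of UNIV "apply_bcontfun s"])
        (auto intro!: continuous_intros)
    then show ?thesis
      using continuous_on_compose2[OF cont, of UNIV "\<lambda>p. ((snd p)\<^sup>2 * fst p, s ((snd p)\<^sup>2 * fst p))"]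
      by (simp add: case_prod_unfold continuous_intros)
  qed
  have int: "(\<lambda>\<theta>. \<Phi> (\<theta>\<^sup>2 * w) (s (\<theta>\<^sup>2 * w))) integrable_on {0..1}" for s :: "real \<Rightarrow>\<^sub>C real" and w
  proof (rule integrable_continuous_real)
    show "continuous_on {0..1} (\<lambda>\<theta>. \<Phi> (\<theta>\<^sup>2 * w) (s (\<theta>\<^sup>2 * w)))"
      using continuous_on_compose2[OF cont_pair[of s], of "{0..1}" "\<lambda>\<theta>. (w, \<theta>)"]
      by (simp add: continuous_intros)
  qed
  have T_cont: "continuous_on UNIV (T s)" for s
  proof -
    have "continuous_on (UNIV \<times> cbox 0 1) (\<lambda>(w, \<theta>). \<Phi> (\<theta>\<^sup>2 * w) (s (\<theta>\<^sup>2 * w)))"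
      by (rule continuous_on_subset[OF cont_pair]) auto
    from integral_continuous_on_param[OF this] show ?thesis
      unfolding T_def by simp
  qed
  have T_bcontfun: "T s \<in> bcontfun" for s
  proof (rule bcontfun_normI[OF T_cont])
    fix w
    have "norm (integral {0..1} (\<lambda>\<theta>. \<Phi> (\<theta>\<^sup>2 * w) (s (\<theta>\<^sup>2 * w)))) \<le> integral {0..1::real} (\<lambda>\<theta>. B)"
      by (rule integral_norm_bound_integral[OF int]) (auto simp: bound)
    then show "norm (T s w) \<le> B" by (simp add: T_def)
  qed
  have apply_T: "apply_bcontfun (Bcontfun (T s)) = T s" for s
    by (rule Bcontfun_inverse[OF T_bcontfun])
  have "dist (Bcontfun (T s)) (Bcontfun (T s')) \<le> q * dist s s'" for s s'
  proof (rule dist_bound)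
    fix w
    have "norm (integral {0..1} (\<lambda>\<theta>. \<Phi> (\<theta>\<^sup>2 * w) (s (\<theta>\<^sup>2 * w)) - \<Phi> (\<theta>\<^sup>2 * w) (s' (\<theta>\<^sup>2 * w))))
        \<le> integral {0..1::real} (\<lambda>\<theta>. q * dist s s')"
    proof (rule integral_norm_bound_integral)
      fix \<theta> :: real
      have "\<bar>\<Phi> (\<theta>\<^sup>2 * w) (s (\<theta>\<^sup>2 * w)) - \<Phi> (\<theta>\<^sup>2 * w) (s' (\<theta>\<^sup>2 * w))\<bar>
          \<le> q * dist (s (\<theta>\<^sup>2 * w)) (s' (\<theta>\<^sup>2 * w))"
        using lip by (simp add: dist_real_def)
      also have "\<dots> \<le> q * dist s s'"
        by (intro mult_left_mono dist_bounded q)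
      finally show "norm (\<Phi> (\<theta>\<^sup>2 * w) (s (\<theta>\<^sup>2 * w)) - \<Phi> (\<theta>\<^sup>2 * w) (s' (\<theta>\<^sup>2 * w))) \<le> q * dist s s'"
        by simp
    qed (auto intro!: integrable_diff int)
    then show "dist (apply_bcontfun (Bcontfun (T s)) w) (apply_bcontfun (Bcontfun (T s')) w)
        \<le> q * dist s s'"
      by (simp add: apply_T dist_real_def T_def integral_diff[OF int int])
  qed
  then obtain s where "Bcontfun (T s) = s"
    using banach_fix_type[OF q, of "\<lambda>s. Bcontfun (T s)"] by blast
  then have fp: "apply_bcontfun s = T s" using apply_T[of s] by simp
  show thesis
  proof (rule that)
    show "continuous_on UNIV (apply_bcontfun s)" by (rule continuous_on_apply_bcontfun)
    show "apply_bcontfun s w = integral {0..1} (\<lambda>\<theta>. \<Phi> (\<theta>\<^sup>2 * w) (s (\<theta>\<^sup>2 * w)))" for w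
      using fun_cong[OF fp, of w] unfolding T_def .
  qed
qed

lemma continuous_antiderivative:
  fixes f :: "real \<Rightarrow> real"
  assumes "continuous_on UNIV f"
  obtains F where "F 0 = 0" "\<And>x. (F has_real_derivative f x) (at x)"
proof -
  obtain F where F: "\<And>x. (F has_vector_derivative f x) (at x)"
    using einterval_antiderivative[of "-\<infinity>" "\<infinity>" f] assms
    by (auto simp: continuous_on_eq_continuous_at)
  show thesis
  proof (rule that[of "\<lambda>x. F x - F 0"])
    show "((\<lambda>x. F x - F 0) has_real_derivative f x) (at x)" for x
      using F[of x] by (auto simp: has_real_derivative_iff_has_vector_derivative intro!: derivative_eq_intros)
  qed simp
qed

lemma even_of_odd_derivative:
  fixes F f :: "real \<Rightarrow> real"
  assumes "\<And>x. (F has_real_derivative f x) (at x)" "\<And>x. f (- x) = - f x"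
  shows "F (- x) = F x"
proof -
  have "((\<lambda>x. F (- x)) has_real_derivative f (- x) * - 1) (at x)" for x
    by (rule DERIV_chain2[of F "f (- x)" uminus]) (auto intro!: assms derivative_eq_intros)
  then have "((\<lambda>x. F (- x) - F x) has_real_derivative 0) (at x)" for x
    using assms by (auto intro!: derivative_eq_intros)
  then have "F (- x) - F x = F (- 0) - F 0"
    by (intro DERIV_isconst_all) auto
  then show ?thesis by auto
qed

lemma odd_of_even_derivative:
  fixes F f :: "real \<Rightarrow> real"
  assumes "\<And>x. (F has_real_derivative f x) (at x)" "\<And>x. f (- x) = f x" "F 0 = 0"
  shows "F (- x) = - F x"
proof -
  have "((\<lambda>x. F (- x)) has_real_derivative f (- x) * - 1) (at x)" for x
    by (rule DERIV_chain2[of F "f (- x)" uminus]) (auto intro!: assms derivative_eq_intros)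
  then have "((\<lambda>x. F (- x) + F x) has_real_derivative 0) (at x)" for x
    using assms by (auto intro!: derivative_eq_intros)
  then have "F (- x) + F x = F (- 0) + F 0"
    by (intro DERIV_isconst_all) auto
  with assms(3) show ?thesis by auto
qed

text \<open>Substituting \<open>r = \<theta> * y\<close> turns \<open>y * s (y^2)\<close> into the
  integral of \<open>\<Phi> (r^2) (s (r^2))\<close> from 0 to \<open>y\<close>. Hence a fixed point
  of the averaging yields a solution \<open>z = y s(y^2)\<close> of the differential equation, at
  \<open>y = 0\<close> as well, since no division by \<open>y\<close> occurs.\<close>

lemma scaled_average_has_derivative:
  fixes s :: "real \<Rightarrow> real" and \<Phi> :: "real \<Rightarrow> real \<Rightarrow> real"
  assumes cont: "continuous_on UNIV (\<lambda>y. \<Phi> (y\<^sup>2) (s (y\<^sup>2)))"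
    and s: "\<And>w. s w = integral {0..1} (\<lambda>\<theta>. \<Phi> (\<theta>\<^sup>2 * w) (s (\<theta>\<^sup>2 * w)))"
  shows "((\<lambda>y. y * s (y\<^sup>2)) has_real_derivative \<Phi> (y\<^sup>2) (s (y\<^sup>2))) (at y)"
proof -
  obtain G where G0: "G 0 = 0"
    and G: "\<And>y. (G has_real_derivative \<Phi> (y\<^sup>2) (s (y\<^sup>2))) (at y)"
    using continuous_antiderivative[OF cont] by blast
  have "y * s (y\<^sup>2) = G y" for y
  proof -
    have "((\<lambda>\<theta>. G (\<theta> * y)) has_real_derivative \<Phi> ((\<theta> * y)\<^sup>2) (s ((\<theta> * y)\<^sup>2)) * y) (at \<theta>)" for \<theta>
      by (rule DERIV_chain2[OF G]) (auto intro!: derivative_eq_intros)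
    then have "((\<lambda>\<theta>. \<Phi> ((\<theta> * y)\<^sup>2) (s ((\<theta> * y)\<^sup>2)) * y) has_integral (G (1 * y) - G (0 * y))) {0..1}"
      by (intro fundamental_theorem_of_calculus)
        (auto simp: has_real_derivative_iff_has_vector_derivative[symmetric] intro: has_field_derivative_at_within)
    then have "integral {0..1} (\<lambda>\<theta>. \<Phi> ((\<theta> * y)\<^sup>2) (s ((\<theta> * y)\<^sup>2)) * y) = G y"
      using G0 by (simp add: integral_unique del: integral_mult_left)
    then show ?thesis
      using s[of "y\<^sup>2"] by (simp add: power_mult_distrib mult.commute)
  qed
  then have "(\<lambda>y. y * s (y\<^sup>2)) = G" by auto
  then show ?thesis using G by simp
qed

text \<open>The cutoff \<open>N\<close> keeps the contraction factor below 1. The equation is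
  claimed only for \<open>\<bar>y\<bar> < N\<close>, where the clamping of \<open>y^2\<close> is
  inactive, while oddness, continuity and the two bounds hold for all \<open>y\<close>.\<close>

lemma slope_ode_solution:
  fixes N :: real
  assumes "N > 0"
  obtains z where "\<And>y. z (- y) = - z y" "continuous_on UNIV z"
    "\<And>y. 2 * y\<^sup>2 \<le> y * z y" "\<And>y. y * z y \<le> 4 * y\<^sup>2"
    "\<And>y. \<bar>y\<bar> < N \<Longrightarrow> (z has_real_derivative 2 + y * z y / (1 - y\<^sup>2 + y * z y)) (at y)"
proof -
  \<comment> \<open>In terms of \<open>w = y\<^sup>2\<close> and \<open>s = z/y\<close> the right-hand side is \<open>2 + w s/(1 + (s - 1) w)\<close>. It maps
    \<open>w \<ge> 0\<close>, \<open>2 \<le> s \<le> 4\<close> into \<open>[2, 4]\<close>; clamping \<open>w\<close> and \<open>s\<close> makes it a contraction in \<open>s\<close>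
    with the factor \<open>M/(1 + M)\<close>.\<close>
  define M where "M = N\<^sup>2"
  have M: "M > 0" using assms by (simp add: M_def)
  define c where "c w = max 0 (min M w)" for w
  define k where "k s = max 2 (min 4 s)" for s :: real
  define \<Phi> where "\<Phi> w s = 2 + c w * k s / (1 + (k s - 1) * c w)" for w s
  have c: "0 \<le> c w" "c w \<le> M" for w using M by (auto simp: c_def)
  have k: "2 \<le> k s" "k s \<le> 4" for s by (auto simp: k_def)
  \<comment> \<open>Since \<open>k s \<ge> 2\<close>, the denominator has a positive lower bound
    that does not depend on \<open>s\<close>.\<close>
  have D: "1 + c w \<le> 1 + (k s - 1) * c w" for w s
    using mult_right_mono[of 1 "k s - 1" "c w"] c[of w] k[of s] by simp
  have D0: "0 < 1 + (k s - 1) * c w" for w s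
    using D[of w s] c[of w] by simp
  have D1: "1 + (k s - 1) * c w \<noteq> 0" for w s
    by (rule less_imp_neq[OF D0, symmetric])
  have \<Phi>_bounds: "2 \<le> \<Phi> w s \<and> \<Phi> w s \<le> 4" for w s
  proof
    show "2 \<le> \<Phi> w s"
      using c[of w] k[of s] D0[of s w] by (simp add: \<Phi>_def)
    have "0 \<le> (k s - 2) * c w" using c[of w] k[of s] by simp
    then have "c w * k s \<le> 2 * (1 + (k s - 1) * c w)"
      by (simp add: algebra_simps)
    then show "\<Phi> w s \<le> 4"
      using D0[of s w] by (simp add: \<Phi>_def pos_divide_le_eq)
  qed
  have cont: "continuous_on UNIV (\<lambda>(w, s). \<Phi> w s)"
    unfolding \<Phi>_def case_prod_unfold
    using D1 by (auto simp: c_def k_def intro!: continuous_intros)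
  have lip: "\<bar>\<Phi> w s - \<Phi> w s'\<bar> \<le> M / (1 + M) * \<bar>s - s'\<bar>" for w s s'
  proof -
    let ?D = "1 + (k s - 1) * c w" and ?D' = "1 + (k s' - 1) * c w"
    \<comment> \<open>Over the common denominator the terms with \<open>k s * k s'\<close> cancel,
      which leaves a multiple of \<open>k s - k s'\<close>.\<close>
    have "\<Phi> w s - \<Phi> w s' = c w * (1 - c w) * (k s - k s') / (?D * ?D')"
      using D0[of s w] D0[of s' w] by (simp add: \<Phi>_def diff_frac_eq algebra_simps)
    then have "\<bar>\<Phi> w s - \<Phi> w s'\<bar> = c w * \<bar>1 - c w\<bar> * \<bar>k s - k s'\<bar> / (?D * ?D')"
      using D0[of s w] D0[of s' w] c[of w] by (simp add: abs_mult)
    \<comment> \<open>Here |1 - c| \<le> 1 + c, both denominators are at least 1 + c, and clamping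
      does not increase distances.\<close>
    also have "\<dots> \<le> c w * (1 + c w) * \<bar>s - s'\<bar> / ((1 + c w) * (1 + c w))"
    proof (intro frac_le mult_mono mult_nonneg_nonneg)
      show "\<bar>k s - k s'\<bar> \<le> \<bar>s - s'\<bar>" by (auto simp: k_def)
    qed (use c[of w] D[of w s] D[of w s'] in \<open>auto intro: mult_pos_pos\<close>)
    also have "\<dots> = c w / (1 + c w) * \<bar>s - s'\<bar>"
      using c[of w] by simp
    also have "\<dots> \<le> M / (1 + M) * \<bar>s - s'\<bar>"
      using c[of w] M by (intro mult_right_mono) (auto simp: field_simps)
    finally show ?thesis .
  qed
  obtain s where s_cont: "continuous_on UNIV s"
    and s: "\<And>w. s w = integral {0..1} (\<lambda>\<theta>. \<Phi> (\<theta>\<^sup>2 * w) (s (\<theta>\<^sup>2 * w)))"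
  proof (rule averaging_fixed_point[of \<Phi> 4 "M / (1 + M)"])
    show "\<bar>\<Phi> w s\<bar> \<le> 4" for w s using \<Phi>_bounds[of w s] by simp
    show "continuous_on UNIV (\<lambda>(w, s). \<Phi> w s)" by (rule cont)
    show "\<bar>\<Phi> w s - \<Phi> w s'\<bar> \<le> M / (1 + M) * \<bar>s - s'\<bar>" for w s s' by (rule lip)
    show "0 \<le> M / (1 + M)" "M / (1 + M) < 1" using M by simp_all
  qed blast
  have cont_s: "continuous_on S (\<lambda>x. s (g x))" if "continuous_on S g" for S :: "real set" and g
    by (rule continuous_on_compose2[OF s_cont that]) auto
  have cont_\<Phi>: "continuous_on S (\<lambda>y. \<Phi> (g y) (s (g y)))" if "continuous_on S g" for S :: "real set" and g
    using continuous_on_compose2[OF cont, of S "\<lambda>y. (g y, s (g y))"] that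
    by (simp add: continuous_intros cont_s)
  have s_bounds: "2 \<le> s w \<and> s w \<le> 4" for w
  proof -
    have int: "(\<lambda>\<theta>. \<Phi> (\<theta>\<^sup>2 * w) (s (\<theta>\<^sup>2 * w))) integrable_on {0..1}"
      by (intro integrable_continuous_real cont_\<Phi> continuous_intros)
    have "integral {0..1::real} (\<lambda>\<theta>. 2) \<le> s w" "s w \<le> integral {0..1::real} (\<lambda>\<theta>. 4)"
      using \<Phi>_bounds by (auto simp only: s[of w] intro!: integral_le int)
    then show ?thesis by simp
  qed
  show thesis
  proof (rule that[of "\<lambda>y. y * s (y\<^sup>2)"])
    show "continuous_on UNIV (\<lambda>y. y * s (y\<^sup>2))"
      by (intro continuous_intros cont_s)
    show "2 * y\<^sup>2 \<le> y * (y * s (y\<^sup>2))" for y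
      using mult_right_mono[of 2 "s (y\<^sup>2)" "y\<^sup>2"] s_bounds[of "y\<^sup>2"]
      by (simp add: power2_eq_square ac_simps)
    show "y * (y * s (y\<^sup>2)) \<le> 4 * y\<^sup>2" for y
      using mult_right_mono[of "s (y\<^sup>2)" 4 "y\<^sup>2"] s_bounds[of "y\<^sup>2"]
      by (simp add: power2_eq_square ac_simps)
    fix y :: real assume "\<bar>y\<bar> < N"
    then have "y\<^sup>2 \<le> M"
      using power_mono[of "\<bar>y\<bar>" N 2] by (simp add: M_def)
    then have "c (y\<^sup>2) = y\<^sup>2" by (simp add: c_def)
    moreover have "k (s (y\<^sup>2)) = s (y\<^sup>2)" using s_bounds[of "y\<^sup>2"] by (simp add: k_def)
    ultimately have "\<Phi> (y\<^sup>2) (s (y\<^sup>2)) = 2 + y * (y * s (y\<^sup>2)) / (1 - y\<^sup>2 + y * (y * s (y\<^sup>2)))"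
      by (simp add: \<Phi>_def power2_eq_square algebra_simps)
    then show "((\<lambda>y. y * s (y\<^sup>2)) has_real_derivative
        2 + y * (y * s (y\<^sup>2)) / (1 - y\<^sup>2 + y * (y * s (y\<^sup>2)))) (at y)"
      using scaled_average_has_derivative[of \<Phi> s y, OF _ s]
      by (simp add: cont_\<Phi> continuous_intros)
  qed simp
qed

lemma le_of_derivative_le:
  fixes f g :: "real \<Rightarrow> real"
  assumes "\<And>x. 0 \<le> x \<Longrightarrow> x \<le> b \<Longrightarrow> (f has_real_derivative f' x) (at x)"
    and "\<And>x. 0 \<le> x \<Longrightarrow> x \<le> b \<Longrightarrow> (g has_real_derivative g' x) (at x)"
    and "\<And>x. 0 \<le> x \<Longrightarrow> x \<le> b \<Longrightarrow> f' x \<le> g' x"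
    and "f 0 = g 0" "0 \<le> b"
  shows "f b \<le> g b"
proof -
  have "(\<lambda>x. g x - f x) 0 \<le> (\<lambda>x. g x - f x) b"
  proof (rule DERIV_nonneg_imp_nondecreasing[OF \<open>0 \<le> b\<close>])
    fix x assume "0 \<le> x" "x \<le> b"
    then show "\<exists>y. ((\<lambda>x. g x - f x) has_real_derivative y) (at x) \<and> 0 \<le> y"
      using assms(3) by (intro exI[of _ "g' x - f' x"]) (auto intro!: DERIV_diff assms(1,2))
  qed
  then show ?thesis using assms(4) by simp
qed

text \<open>As functions of the slope, the logarithm of the radius, the potential and the arc length
  \<open>X\<close> are successive antiderivatives once \<open>z\<close> is known. Since
  \<open>X\<close> is strictly increasing, \<open>inv X\<close> turns them into functions of the arc
  length, with \<open>T = X N\<close>. The conditions \<open>F x = 6 * x\<close> say that F(x)/(2x)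
  = 3.\<close>

lemma soliton_profile:
  obtains T :: real and F y z u :: "real \<Rightarrow> real" and x1 x2 where
    "\<And>x. \<bar>x\<bar> < T \<Longrightarrow> F x > 0"
    "\<And>x. \<bar>x\<bar> < T \<Longrightarrow> (F has_real_derivative y x) (at x)"
    "\<And>x. \<bar>x\<bar> < T \<Longrightarrow> (y has_real_derivative (1 - (y x)\<^sup>2 + y x * z x) / F x) (at x)"
    "\<And>x. \<bar>x\<bar> < T \<Longrightarrow> (z has_real_derivative (2 - 2 * (y x)\<^sup>2 + 3 * (y x * z x)) / F x) (at x)"
    "\<And>x. \<bar>x\<bar> < T \<Longrightarrow> (u has_real_derivative z x / F x) (at x)"
    "\<And>x. \<bar>x\<bar> < T \<Longrightarrow> F (- x) = F x" "\<And>x. \<bar>x\<bar> < T \<Longrightarrow> u (- x) = u x"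
    "F 0 = 1" "0 < x1" "x1 < x2" "x2 < T" "F x1 = 6 * x1" "F x2 = 6 * x2"
proof -
  \<comment> \<open>The right side will bound the radius at slope \<open>Y\<close> from below and
    grows like Y^(1/3); the logarithm on the left is \<open>arsinh Y\<close>, which will bound the
    arc length from above.\<close>
  have "eventually (\<lambda>Y. 6 * ln (Y + sqrt (Y\<^sup>2 + 1)) < exp (ln (1 + 3 * Y\<^sup>2) / 6)) (at_top :: real filter)"
    by real_asymp
  then have "eventually (\<lambda>Y. 1 < Y \<and> 6 * ln (Y + sqrt (Y\<^sup>2 + 1)) < exp (ln (1 + 3 * Y\<^sup>2) / 6))
      (at_top :: real filter)"
    by (intro eventually_conj eventually_gt_at_top)
  then obtain Y :: real where Y: "1 < Y" "6 * arsinh Y < exp (ln (1 + 3 * Y\<^sup>2) / 6)"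
    unfolding arsinh_real_def by (auto simp: eventually_at_top_linorder)
  \<comment> \<open>The margin 1 makes every slope up to \<open>Y\<close> an interior point of the
    range where the equation for \<open>z\<close> holds.\<close>
  define N where "N = Y + 1"
  obtain z where z_odd: "\<And>y. z (- y) = - z y" and z_cont: "continuous_on UNIV z"
    and z_lower: "\<And>y. 2 * y\<^sup>2 \<le> y * z y" and z_upper: "\<And>y. y * z y \<le> 4 * y\<^sup>2"
    and z_deriv: "\<And>y. \<bar>y\<bar> < N \<Longrightarrow>
      (z has_real_derivative 2 + y * z y / (1 - y\<^sup>2 + y * z y)) (at y)"
    using slope_ode_solution[of N] Y(1) by (auto simp: N_def)

  \<comment> \<open>Radius, potential and arc length as functions of the slope\<close>
  define D where "D y = 1 - y\<^sup>2 + y * z y" for y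
  have D: "1 + y\<^sup>2 \<le> D y" "D y \<le> 1 + 3 * y\<^sup>2" for y
    using z_lower[of y] z_upper[of y] by (auto simp: D_def)
  have D_pos: "D y > 0" for y using D(1)[of y] by (rule less_le_trans[rotated]) (simp add: add_pos_nonneg)
  have D_even: "D (- y) = D y" for y by (simp add: D_def z_odd)
  have D_cont: "continuous_on UNIV D"
    unfolding D_def by (intro continuous_intros z_cont)
  have D_neq: "D y \<noteq> 0" for y using D_pos[of y] by simp
  \<comment> \<open>\<open>exp L\<close>, \<open>V\<close> and \<open>X\<close> are \<open>F\<close>, \<open>u\<close> and the arc length \<open>x\<close> as functions of the slope.\<close>
  obtain L where L0: "L 0 = 0" and L: "\<And>y. (L has_real_derivative y / D y) (at y)"
    by (rule continuous_antiderivative[of "\<lambda>y. y / D y"])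
      (intro continuous_intros D_cont ballI D_neq, blast)
  obtain V where V: "\<And>y. (V has_real_derivative z y / D y) (at y)"
    by (rule continuous_antiderivative[of "\<lambda>y. z y / D y"])
      (intro continuous_intros D_cont z_cont ballI D_neq, blast)
  have L_cont: "continuous_on UNIV L"
    by (intro continuous_at_imp_continuous_on ballI DERIV_isCont[OF L])
  obtain X where X0: "X 0 = 0" and X: "\<And>y. (X has_real_derivative exp (L y) / D y) (at y)"
    by (rule continuous_antiderivative[of "\<lambda>y. exp (L y) / D y"])
      (intro continuous_intros D_cont L_cont ballI D_neq, blast)
  have X_cont: "isCont X y" for y using X by (rule DERIV_isCont)
  have L_even: "L (- y) = L y" for y
    using even_of_odd_derivative[OF L] by (simp add: D_even)
  have V_even: "V (- y) = V y" for y
    using even_of_odd_derivative[OF V] by (simp add: D_even z_odd)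
  have X_odd: "X (- y) = - X y" for y
    using odd_of_even_derivative[OF X] X0 by (simp add: D_even L_even)
  have X_mono: "X a < X b" if "a < b" for a b
    by (rule DERIV_pos_imp_increasing[OF that]) (use X D_pos in \<open>blast intro: divide_pos_pos exp_gt_zero\<close>)
  then have X_inj: "inj X" by (intro strict_mono_imp_inj_on strict_monoI)

  \<comment> \<open>Comparison bounds for the radius and the arc length\<close>
  have pos: "0 < 1 + c * x\<^sup>2" if "c > 0" for c x :: real
    using that by (simp add: add_pos_nonneg)
  \<comment> \<open>\<open>D y \<le> 1 + 3 * y^2\<close> bounds the derivative of \<open>L\<close>
    from below by an explicitly integrable function; \<open>D y \<ge> 1 + y^2\<close> gives the
    upper bound in the same way.\<close>
  have L_lower: "ln (1 + 3 * y\<^sup>2) / 6 \<le> L y" if "0 \<le> y" for y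
  proof (rule le_of_derivative_le[where f = "\<lambda>y. ln (1 + 3 * y\<^sup>2) / 6" and g = L and b = y
        and f' = "\<lambda>y. y / (1 + 3 * y\<^sup>2)" and g' = "\<lambda>y. y / D y"])
    show "((\<lambda>y. ln (1 + 3 * y\<^sup>2) / 6) has_real_derivative x / (1 + 3 * x\<^sup>2)) (at x)" for x
      using pos[of 3 x] by (auto intro!: derivative_eq_intros simp: divide_simps)
    show "x / (1 + 3 * x\<^sup>2) \<le> x / D x" if "0 \<le> x" for x
      using D(2) that by (intro divide_left_mono mult_pos_pos pos D_pos) auto
  qed (simp_all add: L L0 that)
  have L_upper: "L y \<le> ln (1 + y\<^sup>2) / 2" if "0 \<le> y" for y
  proof (rule le_of_derivative_le[where f = L and g = "\<lambda>y. ln (1 + y\<^sup>2) / 2" and b = y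
        and g' = "\<lambda>y. y / (1 + y\<^sup>2)" and f' = "\<lambda>y. y / D y"])
    show "((\<lambda>y. ln (1 + y\<^sup>2) / 2) has_real_derivative x / (1 + x\<^sup>2)) (at x)" for x
      using pos[of 1 x] by (auto intro!: derivative_eq_intros simp: divide_simps)
    show "x / D x \<le> x / (1 + x\<^sup>2)" if "0 \<le> x" for x
      using D(1)[of x] that pos[of 1 x] by (intro divide_left_mono mult_pos_pos D_pos) auto
  qed (simp_all add: L L0 that)
  have exp_L_ge: "1 \<le> exp (L y)" if "0 \<le> y" for y
  proof -
    have "0 \<le> ln (1 + 3 * y\<^sup>2) / 6" by simp
    also note L_lower[OF that]
    finally show ?thesis by simp
  qed
  have exp_L_le: "exp (L y) \<le> sqrt (1 + y\<^sup>2)" if "0 \<le> y" for y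
  proof -
    have "ln (1 + y\<^sup>2) / 2 = ln (sqrt (1 + y\<^sup>2))"
      using pos[of 1 y] by (intro ln_sqrt[symmetric]) simp
    then have "exp (L y) \<le> exp (ln (sqrt (1 + y\<^sup>2)))"
      using L_upper[OF that] by (simp only: exp_le_cancel_iff)
    moreover have "exp (ln (sqrt (1 + y\<^sup>2))) = sqrt (1 + y\<^sup>2)"
      using pos[of 1 y] by (intro exp_ln) simp
    ultimately show ?thesis by (simp only:)
  qed
  \<comment> \<open>The radius is at most sqrt(1 + y^2) and \<open>D y\<close> at least 1 + y^2; the
    resulting bound is the derivative of \<open>arsinh\<close>.\<close>
  have X_deriv_le: "exp (L y) / D y \<le> 1 / sqrt (1 + y\<^sup>2)" if "0 \<le> y" for y
  proof -
    have "exp (L y) / D y \<le> sqrt (1 + y\<^sup>2) / (1 + y\<^sup>2)"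
      using D[of y] D_pos[of y] pos[of 1 y] exp_L_le[OF that] by (intro frac_le) auto
    also have "\<dots> = 1 / sqrt (1 + y\<^sup>2)"
      using pos[of 1 y] by (subst frac_eq_eq) auto
    finally show ?thesis .
  qed
  have X_le: "X y \<le> arsinh y" if "0 \<le> y" for y
  proof (rule le_of_derivative_le[OF X, where b = y and g = arsinh and g' = "\<lambda>y. 1 / sqrt (1 + y\<^sup>2)"])
    show "(arsinh has_real_derivative 1 / sqrt (1 + x\<^sup>2)) (at x)" for x
      using arsinh_real_has_field_derivative[of x UNIV] by (simp add: add.commute)
  qed (simp_all add: X0 X_deriv_le that)
  have X_le_self: "X y \<le> y" if "0 \<le> y" for y
  proof (rule le_of_derivative_le[OF X, where b = y and g = "\<lambda>y. y" and g' = "\<lambda>y. 1"])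
    show "exp (L x) / D x \<le> 1" if "0 \<le> x" for x
      using X_deriv_le[OF that] pos[of 1 x] by (auto elim!: order_trans)
  qed (simp_all add: X0 that)
  \<comment> \<open>On [0,1] the radius is at least 1 and \<open>D\<close> at most 4, so
    \<open>X\<close> grows at rate at least 1/4.\<close>
  have X1: "1 / 4 \<le> X 1"
  proof (rule le_of_derivative_le[OF _ X, where b = 1 and f = "\<lambda>y. y / 4" and f' = "\<lambda>y. 1 / 4"])
    fix x :: real assume x: "0 \<le> x" "x \<le> 1"
    then have "x\<^sup>2 \<le> 1" by (simp add: power_le_one)
    then have "D x \<le> 4" using D(2)[of x] by simp
    then show "1 / 4 \<le> exp (L x) / D x"
      using D_pos[of x] exp_L_ge[OF x(1)] by (intro frac_le) auto
  qed (auto intro!: derivative_eq_intros simp: X0)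

  \<comment> \<open>Two slopes with boundary radius 3, as sign changes of \<open>H\<close>\<close>
  define H where "H y = exp (L y) - 6 * X y" for y
  have H_cont: "continuous_on S H" for S
    unfolding H_def
    by (intro continuous_intros continuous_on_subset[OF L_cont]
        continuous_at_imp_continuous_on ballI X_cont) auto
  \<comment> \<open>The bounds give \<open>H 1 \<le> sqrt 2 - 6/4\<close>.\<close>
  have H1: "H 1 < 0"
  proof -
    have "sqrt 2 < 3 / 2" by (rule real_less_lsqrt) (simp_all add: power2_eq_square)
    then show ?thesis using exp_L_le[of 1] X1 by (simp add: H_def)
  qed
  \<comment> \<open>The point 1/6 is where \<open>6 * X y \<le> 6 * y\<close> meets the lower bound
    1 for the radius.\<close>
  have "0 \<le> H (1 / 6)"
    using exp_L_ge[of "1 / 6"] X_le_self[of "1 / 6"] unfolding H_def by linarith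
  then obtain y1 where y1: "1 / 6 \<le> y1" "y1 \<le> 1" "H y1 = 0"
    using IVT2'[OF _ _ _ H_cont, of 1 0 "1 / 6"] H1 by (auto simp del: divide_le_eq_numeral1)
  have "exp (ln (1 + 3 * Y\<^sup>2) / 6) \<le> exp (L Y)"
    using L_lower[of Y] Y(1) by simp
  then have "0 \<le> H Y"
    using X_le[of Y] Y unfolding H_def by linarith
  then obtain y2 where y2: "1 \<le> y2" "y2 \<le> Y" "H y2 = 0"
    using IVT'[OF _ _ _ H_cont, of 1 0 Y] H1 Y(1) by auto
  \<comment> \<open>The two intervals share only the point 1, which is not a zero of
    \<open>H\<close>.\<close>
  have "y1 < y2" using y1 y2 H1 by (cases "y1 = 1") auto

  \<comment> \<open>Inversion of the arc length\<close>
  define \<xi> where "\<xi> = inv X"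
  have \<xi>_X: "\<xi> (X y) = y" for y by (simp add: \<xi>_def X_inj)
  \<comment> \<open>\<open>inv X\<close> is meaningful only on the range of \<open>X\<close>. By the
    intermediate value theorem and \<open>X (- N) = - X N\<close> this range covers all x with |x| <
    X N, with slopes below \<open>N\<close> in absolute value.\<close>
  have preimage: "\<exists>y. \<bar>y\<bar> < N \<and> X y = x" if "\<bar>x\<bar> < X N" for x
  proof -
    have "\<exists>y\<ge>- N. y \<le> N \<and> X y = x"
      using that X_odd[of N] X_cont Y(1)
      by (intro IVT') (auto simp: N_def intro!: continuous_at_imp_continuous_on)
    then obtain y where y: "- N \<le> y" "y \<le> N" "X y = x" by blast
    moreover have "y \<noteq> N" "y \<noteq> - N" using y(3) that X_odd[of N] by auto
    ultimately show ?thesis by (intro exI[of _ y]) auto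
  qed
  have \<xi>_deriv: "(\<xi> has_real_derivative D (\<xi> x) / exp (L (\<xi> x))) (at x)"
    if x: "\<bar>x\<bar> < X N" for x
  proof -
    obtain y where y: "\<bar>y\<bar> < N" "X y = x" using preimage[OF x] by blast
    have "(\<xi> has_real_derivative inverse (exp (L y) / D y)) (at x)"
    proof (rule DERIV_inverse_function[of X])
      show "(X has_real_derivative exp (L y) / D y) (at (\<xi> x))"
        using X y(2) \<xi>_X by auto
      show "isCont \<xi> x"
        using isCont_inverse_function2[of "- N" y N \<xi> X] y \<xi>_X X_cont by auto
      fix x' assume "- X N < x'" "x' < X N"
      then have "\<bar>x'\<bar> < X N" by linarith
      from preimage[OF this] show "X (\<xi> x') = x'"
      proof (elim exE conjE)
        fix y' assume "X y' = x'"
        then show ?thesis using \<xi>_X[of y'] by simp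
      qed
    qed (use x in \<open>auto simp: D_neq\<close>)
    then show ?thesis using y(2) \<xi>_X[of y] by simp
  qed
  have \<xi>_range: "\<bar>\<xi> x\<bar> < N" if x: "\<bar>x\<bar> < X N" for x
  proof -
    obtain y where "\<bar>y\<bar> < N" "X y = x" using preimage[OF x] by blast
    then show ?thesis using \<xi>_X[of y] by simp
  qed
  have \<xi>_odd: "\<xi> (- x) = - \<xi> x" if x: "\<bar>x\<bar> < X N" for x
  proof -
    obtain y where "X y = x" using preimage[OF x] by blast
    then show ?thesis using \<xi>_X[of y] \<xi>_X[of "- y"] X_odd[of y] by simp
  qed
  show thesis
  proof (rule that[of "X N" "\<lambda>x. exp (L (\<xi> x))" \<xi> "\<lambda>x. z (\<xi> x)" "\<lambda>x. V (\<xi> x)" "X y1" "X y2"])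
    fix x assume x: "\<bar>x\<bar> < X N"
    note d = \<xi>_deriv[OF x]
    show "((\<lambda>x. exp (L (\<xi> x))) has_real_derivative \<xi> x) (at x)"
      by (rule DERIV_cong[OF DERIV_fun_exp[OF DERIV_chain2[OF L d]]]) (simp add: D_neq)
    show "(\<xi> has_real_derivative (1 - (\<xi> x)\<^sup>2 + \<xi> x * z (\<xi> x)) / exp (L (\<xi> x))) (at x)"
      using d by (simp add: D_def)
    show "((\<lambda>x. z (\<xi> x)) has_real_derivative
        (2 - 2 * (\<xi> x)\<^sup>2 + 3 * (\<xi> x * z (\<xi> x))) / exp (L (\<xi> x))) (at x)"
    proof (rule DERIV_cong[OF DERIV_chain2[OF z_deriv[OF \<xi>_range[OF x]] d]])
      \<comment> \<open>The left side is 2 D + y z, and D = 1 - y^2 + y z.\<close>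
      have "(2 + \<xi> x * z (\<xi> x) / D (\<xi> x)) * D (\<xi> x) = 2 - 2 * (\<xi> x)\<^sup>2 + 3 * (\<xi> x * z (\<xi> x))"
        using D_neq[of "\<xi> x"] by (simp add: distrib_right) (simp add: D_def)
      then show "(2 + \<xi> x * z (\<xi> x) / (1 - (\<xi> x)\<^sup>2 + \<xi> x * z (\<xi> x))) * (D (\<xi> x) / exp (L (\<xi> x)))
          = (2 - 2 * (\<xi> x)\<^sup>2 + 3 * (\<xi> x * z (\<xi> x))) / exp (L (\<xi> x))"
        by (simp only: D_def[symmetric] times_divide_eq_right)
    qed
    show "((\<lambda>x. V (\<xi> x)) has_real_derivative z (\<xi> x) / exp (L (\<xi> x))) (at x)"
      by (rule DERIV_cong[OF DERIV_chain2[OF V d]]) (simp add: D_neq)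
    show "exp (L (\<xi> (- x))) = exp (L (\<xi> x))" "V (\<xi> (- x)) = V (\<xi> x)"
      using \<xi>_odd[OF x] by (simp_all add: L_even V_even)
  next
    show "exp (L (\<xi> 0)) = 1" using \<xi>_X[of 0] X0 L0 by simp
    show "0 < X y1" using X_mono[of 0 y1] y1 X0 by simp
    show "X y1 < X y2" "X y2 < X N" using \<open>y1 < y2\<close> y2 by (auto intro!: X_mono simp: N_def)
    show "exp (L (\<xi> (X y1))) = 6 * X y1" "exp (L (\<xi> (X y2))) = 6 * X y2"
      using y1(3) y2(3) by (simp_all add: \<xi>_X H_def)
  qed simp
qed

section \<open>Smoothness of radial functions\<close>

lemma partial_deriv_eqI:
  "(f has_derivative f') (at x) \<Longrightarrow> partial_deriv i f x = f' (axis i 1)"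
  unfolding partial_deriv_def by (metis frechet_derivative_at)

lemma partial_deriv_cong_open:
  assumes "open U" "x \<in> U" "\<And>y. y \<in> U \<Longrightarrow> f y = g y"
  shows "partial_deriv i f x = partial_deriv i g x"
proof -
  have "(f has_derivative D) (at x) \<longleftrightarrow> (g has_derivative D) (at x)" for D
    using has_derivative_transform_within_open[of f D x UNIV U g]
      has_derivative_transform_within_open[of g D x UNIV U f] assms by auto
  then show ?thesis by (simp add: partial_deriv_def frechet_derivative_def)
qed

text \<open>On an open set partial derivatives depend only on the values in that set, so agreement
  passes to derivatives of every order.\<close>

lemma Ck_on_cong:
  assumes "open U"
  shows "(\<And>x. x \<in> U \<Longrightarrow> f x = g x) \<Longrightarrow> Ck_on k U f \<Longrightarrow> Ck_on k U g"
proof (induction k arbitrary: f g)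
  case 0
  then show ?case using continuous_on_cong[of U U f g] by simp
next
  case (Suc k)
  have "g differentiable_on U"
    unfolding differentiable_on_def
  proof
    fix x assume "x \<in> U"
    then show "g differentiable (at x within U)"
      using Suc.prems
      by (intro differentiable_transform_within[of f x U 1 g]) (auto simp: differentiable_on_def)
  qed
  moreover have "Ck_on k U (partial_deriv i g)" for i
  proof (rule Suc.IH)
    show "partial_deriv i f x = partial_deriv i g x" if "x \<in> U" for x
      using partial_deriv_cong_open[OF assms that] Suc.prems(1) by blast
    show "Ck_on k U (partial_deriv i f)" using Suc.prems(2) by simp
  qed
  ultimately show ?case by simp
qed

text \<open>This serves as a certificate of smoothness. Sums and products suffice, because each
  reciprocal that occurs later is itself taken as a generator.\<close>

inductive_set function_algebra :: "('a \<Rightarrow> real) set \<Rightarrow> ('a \<Rightarrow> real) set"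
  for B :: "('a \<Rightarrow> real) set" where
  const: "(\<lambda>_. c) \<in> function_algebra B"
| base: "b \<in> B \<Longrightarrow> b \<in> function_algebra B"
| add: "\<lbrakk>f \<in> function_algebra B; g \<in> function_algebra B\<rbrakk> \<Longrightarrow> (\<lambda>x. f x + g x) \<in> function_algebra B"
| mult: "\<lbrakk>f \<in> function_algebra B; g \<in> function_algebra B\<rbrakk> \<Longrightarrow> (\<lambda>x. f x * g x) \<in> function_algebra B"

lemma function_algebra_diff:
  assumes "f \<in> function_algebra B" "g \<in> function_algebra B"
  shows "(\<lambda>x. f x - g x) \<in> function_algebra B"
proof -
  have "(\<lambda>x. f x + (- 1) * g x) \<in> function_algebra B"
    by (intro function_algebra.intros assms)
  then show ?thesis by simp
qed

lemma function_algebra_power: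
  "f \<in> function_algebra B \<Longrightarrow> (\<lambda>x. f x ^ n) \<in> function_algebra B"
  by (induction n) (auto intro: function_algebra.intros)

lemmas function_algebra_intros =
  function_algebra.const function_algebra.add function_algebra.mult
  function_algebra_diff function_algebra_power

text \<open>By the sum and product rules, closure under partial derivatives passes from the
  generators to the whole algebra. The induction on \<open>k\<close> therefore never leaves the
  algebra, up to agreement on \<open>U\<close>.\<close>

lemma Ck_on_function_algebra:
  fixes U :: "(real^'n::finite) set"
  assumes "open U"
    and diff: "\<And>b. b \<in> B \<Longrightarrow> b differentiable_on U"
    and closed: "\<And>b i. b \<in> B \<Longrightarrow> \<exists>c\<in>function_algebra B. \<forall>x\<in>U. partial_deriv i b x = c x"
  shows "a \<in> function_algebra B \<Longrightarrow> Ck_on k U a"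
proof (induction k arbitrary: a)
  have alg_diff: "a differentiable_on U" if "a \<in> function_algebra B" for a
    using that by induction (auto intro: diff differentiable_on_add differentiable_on_mult)
  have deriv: "(a has_derivative frechet_derivative a (at x)) (at x)"
    if "a \<in> function_algebra B" "x \<in> U" for a x
    using alg_diff[OF that(1)] that(2) \<open>open U\<close>
    by (metis differentiable_on_eq_differentiable_at frechet_derivative_works)
  have alg_closed: "\<exists>c\<in>function_algebra B. \<forall>x\<in>U. partial_deriv i a x = c x"
    if "a \<in> function_algebra B" for a i
    using that
  proof induction
    case (const c)
    have "partial_deriv i (\<lambda>_. c) x = 0" for x
      by (rule partial_deriv_eqI) simp
    then show ?case by (intro bexI[OF _ function_algebra.const[of 0]]) auto
  next
    case (base b)
    then show ?case by (rule closed)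
  next
    case (add f g)
    then obtain f' g' where "f' \<in> function_algebra B" "g' \<in> function_algebra B"
      "\<forall>x\<in>U. partial_deriv i f x = f' x" "\<forall>x\<in>U. partial_deriv i g x = g' x"
      by blast
    moreover have "partial_deriv i (\<lambda>x. f x + g x) x = partial_deriv i f x + partial_deriv i g x"
      if "x \<in> U" for x
      using partial_deriv_eqI[OF has_derivative_add[OF deriv[OF add.hyps(1) that] deriv[OF add.hyps(2) that]]]
      by (simp add: partial_deriv_def)
    ultimately show ?case
      by (intro bexI[OF _ function_algebra.add[of f' B g']]) auto
  next
    case (mult f g)
    then obtain f' g' where "f' \<in> function_algebra B" "g' \<in> function_algebra B"
      "\<forall>x\<in>U. partial_deriv i f x = f' x" "\<forall>x\<in>U. partial_deriv i g x = g' x"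
      by blast
    moreover have "partial_deriv i (\<lambda>x. f x * g x) x = f x * partial_deriv i g x + partial_deriv i f x * g x"
      if "x \<in> U" for x
      using partial_deriv_eqI[OF has_derivative_mult[OF deriv[OF mult.hyps(1) that] deriv[OF mult.hyps(2) that]]]
      by (simp add: partial_deriv_def)
    ultimately show ?case
      using mult.hyps
      by (intro bexI[of _ "\<lambda>x. f x * g' x + f' x * g x"]) (auto intro: function_algebra.intros)
  qed
  {
    case 0
    then show ?case using differentiable_imp_continuous_on[OF alg_diff] by simp
  next
    case (Suc k)
    have "Ck_on k U (partial_deriv i a)" for i
    proof -
      obtain c where c: "c \<in> function_algebra B" "\<forall>x\<in>U. partial_deriv i a x = c x"
        using alg_closed[OF Suc.prems] by blast
      show ?thesis by (rule Ck_on_cong[OF \<open>open U\<close> _ Suc.IH[OF c(1)]]) (use c(2) in simp)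
    qed
    then show ?case using alg_diff[OF Suc.prems] by simp
  }
qed

text \<open>The square of 1/|x| is used because its partial derivatives are polynomials in itself
  and the coordinates.\<close>

definition inv_sq :: "real^3 \<Rightarrow> real" where
  "inv_sq x = 1 / (x \<bullet> x)"

lemma has_derivative_inv_sq:
  assumes "x \<noteq> 0"
  shows "(inv_sq has_derivative (\<lambda>v. - 2 * (inv_sq x)\<^sup>2 * (x \<bullet> v))) (at x)"
  unfolding inv_sq_def[abs_def]
  using assms by (auto intro!: derivative_eq_intros simp: inner_commute power2_eq_square divide_simps)

lemma has_derivative_ln_norm:
  fixes x :: "real^3"
  assumes "x \<noteq> 0"
  shows "((\<lambda>x. ln (norm x)) has_derivative (\<lambda>v. inv_sq x * (x \<bullet> v))) (at x)"
proof -
  have n: "(norm has_derivative (\<lambda>v. v \<bullet> sgn x)) (at x)"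
    by (rule has_derivative_norm[OF assms])
  have "((\<lambda>x. ln (norm x)) has_derivative (\<lambda>v. (1 / norm x) * (v \<bullet> sgn x))) (at x)"
    using has_derivative_compose[OF n DERIV_ln_divide[of "norm x", unfolded has_field_derivative_def]] assms
    by simp
  then show ?thesis
    using assms
    by (simp add: inv_sq_def sgn_div_norm inner_commute divide_simps dot_square_norm power2_eq_square)
qed

text \<open>\<open>(inv_sq x * (x \<bullet> v)) *\<^sub>R x\<close> is the component of
  \<open>v\<close> along \<open>x\<close>; the derivative is the projection to the orthogonal
  complement of \<open>x\<close>, divided by the norm.\<close>

lemma has_derivative_sgn:
  fixes x :: "real^3"
  assumes "x \<noteq> 0"
  shows "(sgn has_derivative (\<lambda>v. (v - (inv_sq x * (x \<bullet> v)) *\<^sub>R x) /\<^sub>R norm x)) (at x)"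
proof -
  have n: "(norm has_derivative (\<lambda>v. v \<bullet> sgn x)) (at x)"
    by (rule has_derivative_norm[OF assms])
  have "((\<lambda>x. x /\<^sub>R norm x) has_derivative
      (\<lambda>v. inverse (norm x) *\<^sub>R v + (- (inverse (norm x) * (v \<bullet> sgn x) * inverse (norm x))) *\<^sub>R x)) (at x)"
    by (rule has_derivative_scaleR[OF Deriv.has_derivative_inverse[OF _ n] has_derivative_ident])
      (use assms in simp)
  moreover have "inverse (norm x) *\<^sub>R v + (- (inverse (norm x) * (v \<bullet> sgn x) * inverse (norm x))) *\<^sub>R x
      = (v - (inv_sq x * (x \<bullet> v)) *\<^sub>R x) /\<^sub>R norm x" for v
    by (simp add: inv_sq_def sgn_div_norm inner_commute scaleR_diff_right dot_square_norm
        power2_eq_square divide_inverse ac_simps)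
  ultimately show ?thesis by (simp add: sgn_div_norm[abs_def])
qed

lemma has_derivative_radial:
  fixes x :: "real^3"
  assumes "x \<noteq> 0" "(h has_real_derivative h') (at (ln (norm x)))"
  shows "((\<lambda>x. h (ln (norm x))) has_derivative (\<lambda>v. (h' * inv_sq x) * (x \<bullet> v))) (at x)"
  using has_derivative_compose[OF has_derivative_ln_norm[OF assms(1)] assms(2)[unfolded has_field_derivative_def]]
  by (simp add: mult.assoc)

lemma open_shell: "open J \<Longrightarrow> open (shell J)"
proof -
  assume "open J"
  have "continuous_on (- {0}) (\<lambda>x :: real^3. ln (norm x))"
    by (intro continuous_intros) auto
  then have "open ((- {0}) \<inter> (\<lambda>x :: real^3. ln (norm x)) -` J)"
    by (intro continuous_open_preimage[OF _ _ \<open>open J\<close>]) auto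
  also have "(- {0}) \<inter> (\<lambda>x :: real^3. ln (norm x)) -` J = shell J"
    by (auto simp: shell_def)
  finally show ?thesis .
qed

text \<open>\<open>ln (norm x)\<close> is the interval coordinate in the chart. If \<open>H\<close>
  is closed under differentiation within its algebra, so is this set, because the i-th partial
  derivative of h(ln |x|) is h'(ln |x|) x_i/|x|^2.\<close>

definition radial_generators :: "(real \<Rightarrow> real) set \<Rightarrow> (real^3 \<Rightarrow> real) set" where
  "radial_generators H = range (\<lambda>i x. x $ i) \<union> {inv_sq} \<union> (\<lambda>h x. h (ln (norm x))) ` H"

lemma radial_in_function_algebra:
  "h \<in> function_algebra H \<Longrightarrow> (\<lambda>x. h (ln (norm x))) \<in> function_algebra (radial_generators H)"
  by (induction rule: function_algebra.induct)
    (auto intro: function_algebra.intros simp: radial_generators_def)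

lemma coordinate_in_function_algebra: "(\<lambda>x. x $ i) \<in> function_algebra (radial_generators H)"
  and inv_sq_in_function_algebra: "inv_sq \<in> function_algebra (radial_generators H)"
  by (auto intro!: function_algebra.base simp: radial_generators_def)

lemmas radial_intros = coordinate_in_function_algebra inv_sq_in_function_algebra
  radial_in_function_algebra

text \<open>The differential of each generator has coefficients in the algebra, so
  \<open>Ck_on_function_algebra\<close> applies on \<open>shell J\<close>. An open \<open>J\<close>
  around [0,1] gives smoothness up to the boundary.\<close>

lemma smooth_on_radial:
  assumes "open J" "S \<subseteq> shell J"
    and H: "\<And>h. h \<in> H \<Longrightarrow> \<exists>h'\<in>function_algebra H. \<forall>t\<in>J. (h has_real_derivative h' t) (at t)"
    and a: "a \<in> function_algebra (radial_generators H)" "\<And>x. x \<in> S \<Longrightarrow> a x = \<phi> x"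
  shows "smooth_on S \<phi>"
proof -
  let ?B = "radial_generators H"
  have gen: "\<exists>c. (\<forall>i. c i \<in> function_algebra ?B) \<and>
      (\<forall>x\<in>shell J. (b has_derivative (\<lambda>v. \<Sum>i\<in>UNIV. c i x * v $ i)) (at x))" if "b \<in> ?B" for b
  proof -
    \<comment> \<open>This covers \<open>inv_sq\<close> and the radial functions, whose gradients
      are multiples of \<open>x\<close>.\<close>
    have linear_case: ?thesis
      if c: "c \<in> function_algebra ?B"
        "\<And>x. x \<in> shell J \<Longrightarrow> (b has_derivative (\<lambda>v. c x * (x \<bullet> v))) (at x)" for c
    proof (intro exI conjI ballI allI)
      show "(\<lambda>x. c x * x $ i) \<in> function_algebra ?B" for i
        by (intro function_algebra_intros c radial_intros)
      show "(b has_derivative (\<lambda>v. \<Sum>i\<in>UNIV. c x * x $ i * v $ i)) (at x)" if "x \<in> shell J" for x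
        using c(2)[OF that] by (simp add: inner_vec_def sum_distrib_left mult.assoc)
    qed
    consider i where "b = (\<lambda>x. x $ i)" | "b = inv_sq" | h where "h \<in> H" "b = (\<lambda>x. h (ln (norm x)))"
      using \<open>b \<in> ?B\<close> by (auto simp: radial_generators_def)
    then show ?thesis
    proof cases
      case (1 i)
      have "(b has_derivative (\<lambda>v. \<Sum>j\<in>UNIV. of_bool (i = j) * v $ j)) (at x)" for x
      proof -
        have "(\<Sum>j\<in>UNIV. of_bool (i = j) * v $ j) = v $ i" for v :: "real^3"
          by (subst sum.cong[OF refl, of _ _ "\<lambda>j. if i = j then v $ j else 0"]) auto
        then show ?thesis
          unfolding 1 by (simp add: bounded_linear_imp_has_derivative bounded_linear_vec_nth)
      qed
      then show ?thesis
        by (intro exI[of _ "\<lambda>j x. of_bool (i = j)"]) (auto intro: function_algebra.const)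
    next
      case 2
      have "(\<lambda>x. - 2 * (inv_sq x)\<^sup>2) \<in> function_algebra ?B"
        by (intro function_algebra_intros radial_intros)
      then show ?thesis
        by (rule linear_case) (unfold 2, rule has_derivative_inv_sq, simp add: shell_def)
    next
      case (3 h)
      obtain h' where h': "h' \<in> function_algebra H" "\<forall>t\<in>J. (h has_real_derivative h' t) (at t)"
        using H[OF 3(1)] by blast
      have "(\<lambda>x. h' (ln (norm x)) * inv_sq x) \<in> function_algebra ?B"
        by (intro function_algebra_intros radial_intros h')
      then show ?thesis
        by (rule linear_case)
          (unfold 3(2), rule has_derivative_radial, auto simp: shell_def intro: h'(2)[rule_format])
    qed
  qed
  have "Ck_on k (shell J) a" for k
  proof (rule Ck_on_function_algebra[OF open_shell[OF \<open>open J\<close>] _ _ a(1)])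
    fix b assume "b \<in> ?B"
    then obtain c where c: "\<And>i. c i \<in> function_algebra ?B"
      "\<And>x. x \<in> shell J \<Longrightarrow> (b has_derivative (\<lambda>v. \<Sum>i\<in>UNIV. c i x * v $ i)) (at x)"
      using gen by blast
    show "b differentiable_on shell J"
      using c(2) by (auto simp: differentiable_on_def differentiable_def intro: has_derivative_at_withinI)
    fix i :: 3
    have "partial_deriv i b x = c i x" if "x \<in> shell J" for x
      using partial_deriv_eqI[OF c(2)[OF that], of i]
      by (simp add: axis_def if_distrib cong: if_cong)
    then show "\<exists>c\<in>function_algebra ?B. \<forall>x\<in>shell J. partial_deriv i b x = c x"
      using c(1) by blast
  qed
  then show ?thesis
    unfolding smooth_on_def
    by (intro exI[of _ "shell J"] exI[of _ a] conjI allI ballI open_shell assms(1,2) a(2))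
qed

section \<open>Curvature of radial metrics\<close>

text \<open>Contractions of such symbols produce only powers of |x|^2, so the Ricci matrix is again
  a combination of the identity and x x^T. The coefficients are checked for each of the nine index
  pairs. The symbols are prescribed on a neighbourhood because they get differentiated.\<close>

lemma ricci_radial:
  fixes G :: "real^3 \<Rightarrow> real^3^3" and P Q S :: "real^3 \<Rightarrow> real"
  assumes "open U" "x \<in> U"
    and \<Gamma>: "\<And>k i j y. y \<in> U \<Longrightarrow> christoffel G k i j y =
      P y * (y $ i * of_bool (j = k) + y $ j * of_bool (i = k)) + Q y * (y $ k * of_bool (i = j))
      + S y * (y $ i * y $ j * y $ k)"
    and P: "(P has_derivative (\<lambda>v. P' * (x \<bullet> v))) (at x)"
    and Q: "(Q has_derivative (\<lambda>v. Q' * (x \<bullet> v))) (at x)"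
    and S: "(S has_derivative (\<lambda>v. S' * (x \<bullet> v))) (at x)"
  defines "N \<equiv> x \<bullet> x"
  shows "ricci G i j x =
    (2 * Q x - 2 * P x + Q' * N - S x * N + (2 * P x + Q x + S x * N) * Q x * N) * of_bool (i = j)
    + (3 * S x - 2 * P' - Q' + (4 * P x + Q x + S x * N) * (2 * P x + S x * N)
        - (6 * (P x)\<^sup>2 + 2 * P x * Q x + 4 * P x * S x * N + (Q x)\<^sup>2 + 2 * Q x * S x * N + (S x * N)\<^sup>2))
      * (x $ i * x $ j)"
proof -
  define d where "d a b = (of_bool (a = b) :: real)" for a b :: 3
  have d: "axis a 1 $ b = d a b" for a b :: 3
    by (auto simp: d_def axis_def)
  have comp: "((\<lambda>y. y $ a) has_derivative (\<lambda>v. v $ a)) (at x)" for a :: 3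
    by (rule bounded_linear_imp_has_derivative[OF bounded_linear_vec_nth])
  have dot: "x \<bullet> axis m 1 = x $ m" for m by (simp add: inner_axis)
  have pd: "partial_deriv m (christoffel G k i j) x =
      P' * x $ m * (x $ i * d j k + x $ j * d i k) + P x * (d m i * d j k + d m j * d i k)
      + Q' * x $ m * (x $ k * d i j) + Q x * (d m k * d i j)
      + S' * x $ m * (x $ i * x $ j * x $ k)
      + S x * (d m i * x $ j * x $ k + x $ i * d m j * x $ k + x $ i * x $ j * d m k)" for m k i j
  proof -
    have "partial_deriv m (christoffel G k i j) x = partial_deriv m (\<lambda>y.
      P y * (y $ i * d j k + y $ j * d i k) + Q y * (y $ k * d i j) + S y * (y $ i * y $ j * y $ k)) x"
      using \<Gamma> by (intro partial_deriv_cong_open[OF \<open>open U\<close> \<open>x \<in> U\<close>]) (simp add: d_def)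
    also have "\<dots> = P x * (d m i * d j k + d m j * d i k) + P' * x $ m * (x $ i * d j k + x $ j * d i k)
      + (Q x * (d m k * d i j) + Q' * x $ m * (x $ k * d i j))
      + (S x * (x $ i * x $ j * d m k + (x $ i * d m j + d m i * x $ j) * x $ k)
          + S' * x $ m * (x $ i * x $ j * x $ k))"
      by (subst partial_deriv_eqI)
        (rule has_derivative_add has_derivative_mult has_derivative_mult_left P Q S comp | simp only: dot d)+
    finally show ?thesis by (simp add: algebra_simps)
  qed
  have \<Gamma>x: "christoffel G k i j x =
      P x * (x $ i * d j k + x $ j * d i k) + Q x * (x $ k * d i j) + S x * (x $ i * x $ j * x $ k)" for k i j
    using \<Gamma>[OF \<open>x \<in> U\<close>] by (simp add: d_def)
  have N: "N = x $ 1 * x $ 1 + x $ 2 * x $ 2 + x $ 3 * x $ 3"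
    by (simp add: N_def inner_vec_def sum_3)
  show ?thesis
    unfolding ricci_def pd \<Gamma>x sum_3 d_def N
    using exhaust_3[of i] exhaust_3[of j]
    by (elim disjE) (simp_all add: algebra_simps power2_eq_square)
qed

definition warped_metric :: "(real \<Rightarrow> real) \<Rightarrow> metric" where
  "warped_metric f = (\<lambda>(p, t) (v, a) (w, b). a * b + (f t)\<^sup>2 * (v \<bullet> w))"

lemma frechet_derivative_chart:
  assumes "x \<noteq> 0"
  shows "frechet_derivative chart (at x) v =
    ((v - (inv_sq x * (x \<bullet> v)) *\<^sub>R x) /\<^sub>R norm x, inv_sq x * (x \<bullet> v))"
proof -
  have "(chart has_derivative (\<lambda>v. ((v - (inv_sq x * (x \<bullet> v)) *\<^sub>R x) /\<^sub>R norm x, inv_sq x * (x \<bullet> v)))) (at x)"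
    unfolding chart_def[abs_def]
    by (intro has_derivative_Pair has_derivative_sgn has_derivative_ln_norm assms)
  from frechet_derivative_at[OF this, symmetric] show ?thesis by (rule fun_cong)
qed

text \<open>This is the inner product of the components of \<open>v\<close> and \<open>w\<close>
  orthogonal to \<open>x\<close>, divided by |x|^2.\<close>

lemma tangential_inner:
  assumes "x \<noteq> 0"
  shows "((v - (inv_sq x * (x \<bullet> v)) *\<^sub>R x) /\<^sub>R norm x) \<bullet> ((w - (inv_sq x * (x \<bullet> w)) *\<^sub>R x) /\<^sub>R norm x)
    = inv_sq x * (v \<bullet> w) - (inv_sq x)\<^sup>2 * (x \<bullet> v) * (x \<bullet> w)"
proof -
  have 1: "inv_sq x * (x \<bullet> x) = 1" using assms by (simp add: inv_sq_def)
  have 2: "inverse (norm x) * inverse (norm x) = inv_sq x"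
    by (simp add: inv_sq_def dot_square_norm power2_eq_square divide_inverse)
  have "((v - (inv_sq x * (x \<bullet> v)) *\<^sub>R x) /\<^sub>R norm x) \<bullet> ((w - (inv_sq x * (x \<bullet> w)) *\<^sub>R x) /\<^sub>R norm x)
      = (inverse (norm x) * inverse (norm x)) * ((v \<bullet> w) - 2 * inv_sq x * (x \<bullet> v) * (x \<bullet> w)
          + (inv_sq x * (x \<bullet> x)) * inv_sq x * (x \<bullet> v) * (x \<bullet> w))"
    by (simp add: inner_diff_left inner_diff_right inner_commute algebra_simps)
  also have "\<dots> = inv_sq x * (v \<bullet> w) - (inv_sq x)\<^sup>2 * (x \<bullet> v) * (x \<bullet> w)"
    unfolding 1 2 by (simp add: algebra_simps power2_eq_square)
  finally show ?thesis .
qed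

text \<open>The matrix has the form a I + b x x^T. Its eigenvalue is f^2/|x|^2 across
  \<open>x\<close> and, after cancellation, 1/|x|^2 along \<open>x\<close>.\<close>

lemma metric_in_chart_warped:
  assumes "x \<noteq> 0"
  shows "metric_in_chart (warped_metric f) x $ i $ j =
    (f (ln (norm x)))\<^sup>2 * inv_sq x * of_bool (i = j)
    + (1 - (f (ln (norm x)))\<^sup>2) * (inv_sq x)\<^sup>2 * (x $ i * x $ j)"
proof -
  have "metric_in_chart (warped_metric f) x $ i $ j =
      inv_sq x * (x \<bullet> axis i 1) * (inv_sq x * (x \<bullet> axis j 1))
      + (f (ln (norm x)))\<^sup>2 * (inv_sq x * ((axis i 1 :: real^3) \<bullet> axis j 1)
        - (inv_sq x)\<^sup>2 * (x \<bullet> axis i 1) * (x \<bullet> axis j 1))"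
    by (simp only: metric_in_chart_def warped_metric_def vec_lambda_beta chart_def case_prod_conv
        frechet_derivative_chart[OF assms] tangential_inner[OF assms])
  moreover have "x \<bullet> axis k 1 = x $ k" for k
    by (simp add: inner_axis)
  moreover have "(axis i 1 :: real^3) \<bullet> axis j 1 = of_bool (i = j)"
    by (simp add: inner_axis_axis)
  ultimately show ?thesis
    by (simp only:) (simp add: algebra_simps power2_eq_square)
qed

lemma matrix_inv_unique_real:
  fixes A B :: "real^'n^'n"
  assumes "A ** B = mat 1"
  shows "matrix_inv A = B"
proof -
  have "B ** A = mat 1" using assms by (simp add: matrix_left_right_inverse)
  then have "matrix_inv A ** A = mat 1"
    using assms someI[of "\<lambda>C. A ** C = mat 1 \<and> C ** A = mat 1" B] by (simp add: matrix_inv_def)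
  then have "matrix_inv A ** (A ** B) = B" by (simp add: matrix_mul_assoc)
  then show ?thesis using assms by (simp add: matrix_mul_rid)
qed

text \<open>The Sherman-Morrison formula for a I + b x x^T.\<close>

lemma matrix_inv_radial:
  fixes x :: "real^3"
  assumes "a \<noteq> 0" "a + b * (x \<bullet> x) \<noteq> 0"
  shows "matrix_inv (\<chi> i j. a * of_bool (i = j) + b * (x $ i * x $ j)) =
    (\<chi> i j. 1 / a * of_bool (i = j) - b / (a * (a + b * (x \<bullet> x))) * (x $ i * x $ j))"
proof (rule matrix_inv_unique_real, unfold vec_eq_iff, intro allI)
  fix i j :: 3
  define N where "N = x \<bullet> x"
  define c where "c = b / (a * (a + b * N))"
  have "a + b * N \<noteq> 0" using assms(2) by (simp add: N_def)
  then have "b / a = (a + b * N) * c"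
    by (simp add: c_def)
  then have c: "b / a = a * c + b * N * c"
    by (simp add: distrib_right)
  have N: "N = x $ 1 * x $ 1 + x $ 2 * x $ 2 + x $ 3 * x $ 3"
    by (simp add: N_def inner_vec_def sum_3)
  have "(\<Sum>k\<in>UNIV. (a * of_bool (i = k) + b * (x $ i * x $ k)) * (1 / a * of_bool (k = j) - c * (x $ k * x $ j)))
      = of_bool (i = j) + (b / a - a * c - b * N * c) * (x $ i * x $ j)"
    unfolding N sum_3
    using exhaust_3[of i] exhaust_3[of j] assms(1)
    by (elim disjE) (simp_all add: algebra_simps)
  then show "((\<chi> i j. a * of_bool (i = j) + b * (x $ i * x $ j)) **
      (\<chi> i j. 1 / a * of_bool (i = j) - b / (a * (a + b * (x \<bullet> x))) * (x $ i * x $ j))) $ i $ j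
      = mat 1 $ i $ j"
    by (simp add: matrix_matrix_mult_def mat_def c c_def N_def)
qed

text \<open>Derivatives of a I + b x x^T involve only Kronecker symbols and coordinates, and the
  inverse is a rank-one perturbation of a scalar matrix; raising the index therefore gives the
  three-term form expected by \<open>ricci_radial\<close>.\<close>

lemma christoffel_radial:
  fixes G :: "real^3 \<Rightarrow> real^3^3" and a b :: "real^3 \<Rightarrow> real"
  assumes "open U" "x \<in> U"
    and G: "\<And>y i j. y \<in> U \<Longrightarrow> G y $ i $ j = a y * of_bool (i = j) + b y * (y $ i * y $ j)"
    and a: "(a has_derivative (\<lambda>v. a' * (x \<bullet> v))) (at x)"
    and b: "(b has_derivative (\<lambda>v. b' * (x \<bullet> v))) (at x)"
    and nz: "a x \<noteq> 0" "a x + b x * (x \<bullet> x) \<noteq> 0"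
  shows "christoffel G k i j x =
    a' / (2 * a x) * (x $ i * of_bool (j = k) + x $ j * of_bool (i = k))
    + (b x - a' / 2) / (a x + b x * (x \<bullet> x)) * (x $ k * of_bool (i = j))
    + (b' / 2 - b x * a' / a x) / (a x + b x * (x \<bullet> x)) * (x $ i * x $ j * x $ k)"
proof -
  define d where "d a b = (of_bool (a = b) :: real)" for a b :: 3
  have d: "axis a 1 $ b = d a b" for a b :: 3
    by (auto simp: d_def axis_def)
  have comp: "((\<lambda>y. y $ a) has_derivative (\<lambda>v. v $ a)) (at x)" for a :: 3
    by (rule bounded_linear_imp_has_derivative[OF bounded_linear_vec_nth])
  have dot: "x \<bullet> axis m 1 = x $ m" for m by (simp add: inner_axis)
  have pd: "partial_deriv m (\<lambda>y. G y $ i $ j) x =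
      a' * x $ m * d i j + b' * x $ m * (x $ i * x $ j) + b x * (d m i * x $ j + x $ i * d m j)" for m i j
  proof -
    have "partial_deriv m (\<lambda>y. G y $ i $ j) x = partial_deriv m (\<lambda>y. a y * d i j + b y * (y $ i * y $ j)) x"
      using G by (intro partial_deriv_cong_open[OF \<open>open U\<close> \<open>x \<in> U\<close>]) (simp add: d_def)
    also have "\<dots> = a' * x $ m * d i j + (b x * (x $ i * d m j + d m i * x $ j) + b' * x $ m * (x $ i * x $ j))"
      by (subst partial_deriv_eqI)
        (rule has_derivative_add has_derivative_mult has_derivative_mult_left a b comp | simp only: dot d)+
    finally show ?thesis by (simp add: algebra_simps)
  qed
  define N where "N = x \<bullet> x"
  have N: "N = x $ 1 * x $ 1 + x $ 2 * x $ 2 + x $ 3 * x $ 3"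
    by (simp add: N_def inner_vec_def sum_3)
  define \<alpha> where "\<alpha> = 1 / a x"
  define \<beta> where "\<beta> = 1 / (a x + b x * N)"
  have nz': "a x \<noteq> 0" "a x + b x * N \<noteq> 0" using nz by (simp_all add: N_def)
  have G': "G x = (\<chi> i j. a x * of_bool (i = j) + b x * (x $ i * x $ j))"
    using G[OF \<open>x \<in> U\<close>] by (simp add: vec_eq_iff)
  have inv: "matrix_inv (G x) $ k $ l = \<alpha> * d k l - b x * \<alpha> * \<beta> * (x $ k * x $ l)" for k l
    unfolding G' by (simp add: matrix_inv_radial[OF nz] d_def \<alpha>_def \<beta>_def N_def)
  \<comment> \<open>Both sides are the eigenvalue of the inverse matrix in the direction
    \<open>x\<close>.\<close>
  have ab: "\<alpha> - b x * \<alpha> * \<beta> * N = \<beta>"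
    using nz' by (simp add: \<alpha>_def \<beta>_def divide_simps)
  \<comment> \<open>These are the Christoffel symbols with the upper index lowered.\<close>
  define v where "v l = a' / 2 * (x $ i * d j l + x $ j * d i l) + (b x - a' / 2) * (x $ l * d i j)
      + b' / 2 * (x $ i * x $ j * x $ l)" for l
  have v: "partial_deriv i (\<lambda>y. G y $ j $ l) x + partial_deriv j (\<lambda>y. G y $ i $ l) x
      - partial_deriv l (\<lambda>y. G y $ i $ j) x = 2 * v l" for l
  proof -
    have sym: "d i j = d j i" "d l i = d i l" "d l j = d j l" by (auto simp: d_def)
    show ?thesis unfolding pd v_def sym by (simp add: algebra_simps)
  qed
  \<comment> \<open>The rank-one part of the inverse sees the lowered symbols only through this
    contraction.\<close>
  have xv: "(\<Sum>l\<in>UNIV. x $ l * v l) = a' * (x $ i * x $ j) + (b x - a' / 2) * N * d i j + b' / 2 * N * (x $ i * x $ j)"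
    unfolding v_def N sum_3 d_def
    using exhaust_3[of i] exhaust_3[of j] by (elim disjE) (simp_all add: algebra_simps)
  have "christoffel G k i j x = (\<Sum>l\<in>UNIV. (\<alpha> * d k l - b x * \<alpha> * \<beta> * (x $ k * x $ l)) * v l)"
    unfolding christoffel_def inv v by (simp add: sum_distrib_left algebra_simps)
  also have "\<dots> = \<alpha> * v k - b x * \<alpha> * \<beta> * x $ k * (\<Sum>l\<in>UNIV. x $ l * v l)"
    unfolding sum_3 d_def using exhaust_3[of k] by (elim disjE) (simp_all add: algebra_simps)
  also have "\<dots> = \<alpha> * (a' / 2) * (x $ i * d j k + x $ j * d i k)
      + (\<alpha> - b x * \<alpha> * \<beta> * N) * (b x - a' / 2) * (x $ k * d i j)
      + ((\<alpha> - b x * \<alpha> * \<beta> * N) * (b' / 2) - b x * \<alpha> * \<beta> * a') * (x $ i * x $ j * x $ k)"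
    unfolding xv unfolding v_def by (simp add: algebra_simps)
  also have "\<dots> = a' / (2 * a x) * (x $ i * d j k + x $ j * d i k)
      + (b x - a' / 2) / (a x + b x * N) * (x $ k * d i j)
      + (b' / 2 - b x * a' / a x) / (a x + b x * N) * (x $ i * x $ j * x $ k)"
    unfolding ab by (simp add: \<alpha>_def \<beta>_def diff_divide_distrib algebra_simps)
  finally show ?thesis by (simp add: d_def N_def)
qed

text \<open>With t = ln |x| the function is exp(-2nt) h(t), whence the term -2n h; the gradient
  x/|x|^2 of t supplies the extra factor \<open>inv_sq x\<close>. All coefficients of the metric and
  of its connection have this form.\<close>

lemma has_derivative_inv_sq_power_radial:
  fixes x :: "real^3"
  assumes "x \<noteq> 0" "(h has_real_derivative h') (at (ln (norm x)))"
  shows "((\<lambda>x. (inv_sq x) ^ n * h (ln (norm x))) has_derivative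
    (\<lambda>v. ((inv_sq x) ^ Suc n * (h' - 2 * n * h (ln (norm x)))) * (x \<bullet> v))) (at x)"
  by (rule has_derivative_eq_rhs[OF has_derivative_mult[OF
        has_derivative_power[OF has_derivative_inv_sq[OF assms(1)]] has_derivative_radial[OF assms]]])
    (cases n; simp add: fun_eq_iff algebra_simps power2_eq_square)

text \<open>Ricci tensor and Hessian are both combinations of the identity and x x^T. The
  coefficient of the identity vanishes by the spherical equation, that of x x^T by the two equations
  together.\<close>

lemma quasi_einstein_warped:
  assumes "open J"
    and pos: "\<And>t. t \<in> J \<Longrightarrow> f t > 0"
    and f: "\<And>t. t \<in> J \<Longrightarrow> (f has_real_derivative f1 t) (at t)"
    and f1: "\<And>t. t \<in> J \<Longrightarrow> (f1 has_real_derivative f2 t) (at t)"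
    and u: "\<And>t. t \<in> J \<Longrightarrow> (u has_real_derivative u1 t) (at t)"
    and u1: "\<And>t. t \<in> J \<Longrightarrow> (u1 has_real_derivative u2 t) (at t)"
    and radial_eq: "\<And>t. t \<in> J \<Longrightarrow> u2 t = 2 * (f2 t / f t)"
    and spherical_eq: "\<And>t. t \<in> J \<Longrightarrow> 1 - (f1 t)\<^sup>2 - f t * f2 t + f t * f1 t * u1 t = 0"
  shows "quasi_einstein 0 0 J (warped_metric f) (\<lambda>q. u (snd q))"
proof -
  define G where "G = metric_in_chart (warped_metric f)"
  define t where "t x = ln (norm x)" for x :: "real^3"
  \<comment> \<open>The exponent 1 matches \<open>has_derivative_inv_sq_power_radial\<close>.\<close>
  define P where "P x = inv_sq x ^ 1 * (f1 (t x) / f (t x) - 1)" for x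
  define Q where "Q x = inv_sq x ^ 1 * (1 - f (t x) * f1 (t x))" for x
  define S where "S x = inv_sq x ^ 2 * (f (t x) * f1 (t x) - 2 * (f1 (t x) / f (t x)))" for x
  have U: "open (shell J)" by (rule open_shell[OF \<open>open J\<close>])
  have shellD: "x \<noteq> 0" "t x \<in> J" "f (t x) > 0" "f (t x) \<noteq> 0" "inv_sq x > 0" "inv_sq x * (x \<bullet> x) = 1"
    if "x \<in> shell J" for x
    using that pos[of "t x"] by (auto simp: shell_def t_def inv_sq_def)
  have \<Gamma>: "christoffel G k i j x =
      P x * (x $ i * of_bool (j = k) + x $ j * of_bool (i = k)) + Q x * (x $ k * of_bool (i = j))
      + S x * (x $ i * x $ j * x $ k)" if x: "x \<in> shell J" for k i j x
  proof -
    note s = shellD[OF x]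
    let ?E = "inv_sq x" and ?f = "f (t x)" and ?f1 = "f1 (t x)"
    let ?a = "\<lambda>x. inv_sq x ^ 1 * (\<lambda>t. (f t)\<^sup>2) (ln (norm x))"
    let ?b = "\<lambda>x. inv_sq x ^ 2 * (\<lambda>t. 1 - (f t)\<^sup>2) (ln (norm x))"
    let ?a' = "?E ^ Suc 1 * (2 * (?f * ?f1) - 2 * ?f\<^sup>2)"
    let ?b' = "?E ^ Suc 2 * (- 2 * (?f * ?f1) - 4 * (1 - ?f\<^sup>2))"
    have G: "G y $ i $ j = ?a y * of_bool (i = j) + ?b y * (y $ i * y $ j)" if "y \<in> shell J" for y i j
      unfolding G_def using shellD(1)[OF that] by (simp add: metric_in_chart_warped)
    have da: "(?a has_derivative (\<lambda>v. ?a' * (x \<bullet> v))) (at x)"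
      by (rule has_derivative_eq_rhs[OF has_derivative_inv_sq_power_radial[OF s(1), where h' = "2 * (?f * ?f1)"]])
        (auto intro!: derivative_eq_intros f s simp: t_def[symmetric])
    have db: "(?b has_derivative (\<lambda>v. ?b' * (x \<bullet> v))) (at x)"
      by (rule has_derivative_eq_rhs[OF has_derivative_inv_sq_power_radial[OF s(1), where h' = "- 2 * (?f * ?f1)"]])
        (auto intro!: derivative_eq_intros f s simp: t_def[symmetric])
    \<comment> \<open>The radial eigenvalue does not involve \<open>f\<close>, because the chart is
      logarithmic and the metric has unit speed in t.\<close>
    have "?a x + ?b x * (x \<bullet> x) = ?E * (?f\<^sup>2 + (1 - ?f\<^sup>2) * (?E * (x \<bullet> x)))"
      by (simp add: t_def algebra_simps power2_eq_square)
    then have ab: "?a x + ?b x * (x \<bullet> x) = ?E" by (simp add: s)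
    have a0: "?a x \<noteq> 0" using s by (simp add: t_def)
    have ab0: "?a x + ?b x * (x \<bullet> x) \<noteq> 0" unfolding ab using s by simp
    have 1: "?a' / (2 * ?a x) = P x"
      using s by (simp add: P_def t_def[symmetric] field_simps power2_eq_square)
    have 2: "(?b x - ?a' / 2) / ?E = Q x"
      using s by (simp add: Q_def t_def[symmetric] field_simps power2_eq_square)
    have 3: "(?b' / 2 - ?b x * ?a' / ?a x) / ?E = S x"
      using s by (simp add: S_def t_def[symmetric] field_simps power2_eq_square power3_eq_cube)
    show ?thesis
      using christoffel_radial[OF U x G da db a0 ab0, of k i j] unfolding ab 1 2 3 by simp
  qed
  show ?thesis
    unfolding quasi_einstein_def Let_def G_def[symmetric]
  proof (intro ballI allI)
    fix x :: "real^3" and i j :: 3 assume x: "x \<in> shell J"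
    note s = shellD[OF x]
    define E F F1 F2 U1 U2 where "E = inv_sq x" "F = f (t x)" "F1 = f1 (t x)" "F2 = f2 (t x)"
      "U1 = u1 (t x)" "U2 = u2 (t x)"
    note vals = this
    \<comment> \<open>\<open>p\<close> is the logarithmic derivative of f and \<open>q\<close> is
      half the derivative of f^2; \<open>p1\<close> and \<open>q1\<close> are their derivatives in
      t.\<close>
    define p q p1 q1 where "p = F1 / F" "q = F * F1" "p1 = F2 / F - (F1 / F)\<^sup>2" "q1 = F1\<^sup>2 + F * F2"
    note pq = this
    define N where "N = x \<bullet> x"
    have EN: "E * N = 1" using s by (simp add: vals N_def)
    have F: "F \<noteq> 0" using s by (simp add: vals)
    have df: "(f has_real_derivative F1) (at (t x))" and df1: "(f1 has_real_derivative F2) (at (t x))"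
      using f f1 s(2) by (simp_all add: vals)
    have dp: "((\<lambda>t. f1 t / f t) has_real_derivative p1) (at (ln (norm x)))"
      unfolding t_def[symmetric]
      by (rule DERIV_cong[OF DERIV_divide[OF df1 df s(4)]])
        (use F in \<open>simp add: pq vals[symmetric] divide_simps power2_eq_square\<close>)
    have dq: "((\<lambda>t. f t * f1 t) has_real_derivative q1) (at (ln (norm x)))"
      unfolding t_def[symmetric]
      by (rule DERIV_cong[OF DERIV_mult[OF df df1]]) (simp add: pq vals power2_eq_square)
    have P: "P x = E * (p - 1)" and Q: "Q x = E * (1 - q)" and S: "S x = E\<^sup>2 * (q - 2 * p)"
      by (simp_all add: P_def Q_def S_def pq vals)
    have dP: "(P has_derivative (\<lambda>v. (E\<^sup>2 * (p1 - 2 * (p - 1))) * (x \<bullet> v))) (at x)"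
      unfolding P_def[abs_def] t_def
      by (rule has_derivative_eq_rhs[OF has_derivative_inv_sq_power_radial[OF s(1) DERIV_diff[OF dp DERIV_const]]])
        (simp add: t_def[symmetric] pq vals power2_eq_square power3_eq_cube)
    have dQ: "(Q has_derivative (\<lambda>v. (E\<^sup>2 * (- q1 - 2 * (1 - q))) * (x \<bullet> v))) (at x)"
      unfolding Q_def[abs_def] t_def
      by (rule has_derivative_eq_rhs[OF has_derivative_inv_sq_power_radial[OF s(1) DERIV_diff[OF DERIV_const dq]]])
        (simp add: t_def[symmetric] pq vals power2_eq_square power3_eq_cube)
    have dS: "(S has_derivative (\<lambda>v. (E ^ 3 * (q1 - 2 * p1 - 4 * (q - 2 * p))) * (x \<bullet> v))) (at x)"
      unfolding S_def[abs_def] t_def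
      by (rule has_derivative_eq_rhs[OF has_derivative_inv_sq_power_radial[OF s(1) DERIV_diff[OF dq DERIV_cmult[OF dp]]]])
        (simp add: t_def[symmetric] pq vals power2_eq_square power3_eq_cube)
    \<comment> \<open>\<open>E * N = 1\<close> absorbs the factors |x|^2, so that powers of
      \<open>E\<close> times polynomials in \<open>p\<close>, \<open>q\<close>, \<open>p1\<close>,
      \<open>q1\<close> remain.\<close>
    have QN: "Q x * N = 1 - q" and SN: "S x * N = E * (q - 2 * p)"
      and Q'N: "E\<^sup>2 * (- q1 - 2 * (1 - q)) * N = E * (- q1 - 2 * (1 - q))"
      using EN by (simp_all add: Q S power2_eq_square mult.assoc mult.left_commute[of _ N])
    have "ricci G i j x = (1 - q1) * E * of_bool (i = j)
        - (2 * (p1 + p\<^sup>2) + (1 - q1)) * E\<^sup>2 * (x $ i * x $ j)"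
    proof -
      have "2 * Q x - 2 * P x + E\<^sup>2 * (- q1 - 2 * (1 - q)) * N - S x * N
          + (2 * P x + Q x + S x * N) * Q x * N = (1 - q1) * E"
        unfolding mult.assoc[of _ "Q x" N] unfolding QN SN Q'N unfolding P Q by (simp add: algebra_simps power2_eq_square)
      moreover have "3 * S x - 2 * (E\<^sup>2 * (p1 - 2 * (p - 1))) - E\<^sup>2 * (- q1 - 2 * (1 - q))
          + (4 * P x + Q x + S x * N) * (2 * P x + S x * N)
          - (6 * (P x)\<^sup>2 + 2 * P x * Q x + 4 * P x * S x * N + (Q x)\<^sup>2 + 2 * Q x * S x * N + (S x * N)\<^sup>2)
          = - (2 * (p1 + p\<^sup>2) + (1 - q1)) * E\<^sup>2"
        unfolding mult.assoc[of _ "S x" N] unfolding SN unfolding P Q S by (simp add: algebra_simps power2_eq_square)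
      ultimately show ?thesis
        using ricci_radial[OF U x \<Gamma> dP dQ dS, of i j] unfolding N_def[symmetric] by (simp only:)
    qed
    moreover have "hessian G (\<lambda>x. u (snd (chart x))) i j x =
        U1 * q * E * of_bool (i = j) + (U2 - U1 * q) * E\<^sup>2 * (x $ i * x $ j)"
    proof -
      let ?U = "\<lambda>x. u (snd (chart x))"
      have pd: "partial_deriv k ?U y = (inv_sq y ^ 1 * u1 (ln (norm y))) * y $ k" if "y \<in> shell J" for k y
        using partial_deriv_eqI[OF has_derivative_radial[OF shellD(1)[OF that] u], of k] shellD(2)[OF that]
        by (simp add: chart_def t_def inner_axis)
      have "partial_deriv i (partial_deriv j ?U) x
          = partial_deriv i (\<lambda>y. (inv_sq y ^ 1 * u1 (ln (norm y))) * y $ j) x"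
        using pd by (intro partial_deriv_cong_open[OF U x])
      also have "\<dots> = E * U1 * of_bool (i = j) + E\<^sup>2 * (U2 - 2 * U1) * x $ i * x $ j"
      proof (subst partial_deriv_eqI[OF has_derivative_mult[OF
            has_derivative_inv_sq_power_radial[OF s(1) u1]
            bounded_linear_imp_has_derivative[OF bounded_linear_vec_nth]]])
        show "ln (norm x) \<in> J" using s by (simp add: t_def)
      qed (simp add: inner_axis vals t_def power2_eq_square, simp add: axis_def)
      finally have "partial_deriv i (partial_deriv j ?U) x
          = E * U1 * of_bool (i = j) + E\<^sup>2 * (U2 - 2 * U1) * x $ i * x $ j" .
      moreover have "(\<Sum>k\<in>UNIV. christoffel G k i j x * partial_deriv k ?U x)
          = E * U1 * (2 * P x * (x $ i * x $ j) + (Q x * N) * of_bool (i = j) + (S x * N) * (x $ i * x $ j))"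
        unfolding pd[OF x] \<Gamma>[OF x] N_def inner_vec_def sum_3
        using exhaust_3[of i] exhaust_3[of j]
        by (elim disjE) (simp_all add: vals t_def algebra_simps)
      ultimately show ?thesis
        unfolding hessian_def QN SN P by (simp only:) (simp add: algebra_simps power2_eq_square)
    qed
    \<comment> \<open>This is the radial equation, since \<open>p1 + p^2 = F2 / F\<close>.\<close>
    moreover have "U2 = 2 * (p1 + p\<^sup>2)"
      using radial_eq[OF s(2)] by (simp add: vals pq)
    moreover have "1 - q1 = - U1 * q"
      using spherical_eq[OF s(2)] by (simp add: vals pq algebra_simps)
    ultimately have "ricci G i j x + hessian G (\<lambda>x. u (snd (chart x))) i j x = 0"
      by (simp only:) (simp add: algebra_simps)
    then show "ricci G i j x + hessian G (\<lambda>x. u (snd (chart x))) i j x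
        - 0 * (partial_deriv i (\<lambda>x. u (snd (chart x))) x * partial_deriv j (\<lambda>x. u (snd (chart x))) x)
        = 0 * G x $ i $ j"
      by simp
  qed
qed

section \<open>The Dirichlet problem\<close>

lemma SO3_inner:
  assumes "A \<in> SO3"
  shows "(A *v v) \<bullet> (A *v w) = v \<bullet> w"
proof -
  have "orthogonal_transformation ((*v) A)"
    using assms by (simp add: SO3_def rotation_matrix_def orthogonal_transformation_matrix)
  then show ?thesis by (simp add: orthogonal_transformation_def)
qed

lemma inner_product_on_scaled: "c \<noteq> 0 \<Longrightarrow> inner_product_on (tangent_S2 p) (\<lambda>v w. c\<^sup>2 * (v \<bullet> w))"
  by (auto simp: inner_product_on_def inner_commute inner_add_left algebra_simps)

lemma riemannian_metric_S2_round:
  assumes "c \<noteq> 0"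
  shows "riemannian_metric_S2 (\<lambda>p v w. c\<^sup>2 * (v \<bullet> w))"
  unfolding riemannian_metric_S2_def
proof (intro conjI ballI allI)
  show "inner_product_on (tangent_S2 p) (\<lambda>v w. c\<^sup>2 * (v \<bullet> w))" for p
    by (rule inner_product_on_scaled[OF assms])
  fix i j :: 3
  let ?a = "\<lambda>x :: real^3. c\<^sup>2 * (inv_sq x * (axis i 1 \<bullet> (axis j 1 :: real^3)) - (inv_sq x)\<^sup>2 * x $ i * x $ j)"
  show "smooth_on (- {0}) (\<lambda>x. c\<^sup>2 * (frechet_derivative sgn (at x) (axis i 1)
      \<bullet> frechet_derivative sgn (at x) (axis j 1)))"
  proof (rule smooth_on_radial[where J = UNIV and H = "{}"])
    show "?a \<in> function_algebra (radial_generators {})"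
      by (intro function_algebra_intros radial_intros)
    fix x :: "real^3" assume "x \<in> - {0}"
    then have x: "x \<noteq> 0" by simp
    have "x \<bullet> axis k 1 = x $ k" for k by (simp add: inner_axis)
    then show "?a x = c\<^sup>2 * (frechet_derivative sgn (at x) (axis i 1)
        \<bullet> frechet_derivative sgn (at x) (axis j 1))"
      unfolding frechet_derivative_at[OF has_derivative_sgn[OF x], symmetric] tangential_inner[OF x]
      by simp
  qed (auto simp: shell_def)
qed

text \<open>The first-order system, together with (1/f)' = -y/f^2, makes \<open>f\<close>, 1/f,
  \<open>y\<close>, \<open>z\<close>, \<open>u\<close> closed under differentiation up to sums and
  products. So all of them are smooth on \<open>J\<close>, a neighbourhood of [0,1].\<close>

lemma dirichlet_quasi_einstein_warped:
  assumes J: "open J" "{0..1} \<subseteq> J"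
    and pos: "\<And>t. t \<in> J \<Longrightarrow> f t > 0"
    and f: "\<And>t. t \<in> J \<Longrightarrow> (f has_real_derivative y t) (at t)"
    and y: "\<And>t. t \<in> J \<Longrightarrow> (y has_real_derivative (1 - (y t)\<^sup>2 + y t * z t) / f t) (at t)"
    and z: "\<And>t. t \<in> J \<Longrightarrow> (z has_real_derivative (2 - 2 * (y t)\<^sup>2 + 3 * (y t * z t)) / f t) (at t)"
    and u: "\<And>t. t \<in> J \<Longrightarrow> (u has_real_derivative z t / f t) (at t)"
    and bc: "f 0 = c" "f 1 = c" "u 0 = 0" "u 1 = 0"
  shows "dirichlet_quasi_einstein 0 0 1 (\<lambda>p v w. c\<^sup>2 * (v \<bullet> w)) (warped_metric f) (\<lambda>q. u (snd q))"
proof -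
  define H where "H = {f, \<lambda>t. 1 / f t, y, z, u}"
  have H_base: "f \<in> function_algebra H" "(\<lambda>t. 1 / f t) \<in> function_algebra H"
    "y \<in> function_algebra H" "z \<in> function_algebra H" "u \<in> function_algebra H"
    by (auto intro!: function_algebra.base simp: H_def)
  have H: "\<exists>h'\<in>function_algebra H. \<forall>t\<in>J. (h has_real_derivative h' t) (at t)" if "h \<in> H" for h
  proof -
    have "((\<lambda>t. 1 / f t) has_real_derivative (- 1) * y t * (1 / f t)\<^sup>2) (at t)" if "t \<in> J" for t
      using pos[OF that]
      by (auto intro!: derivative_eq_intros f that simp: power2_eq_square divide_simps)
    moreover have "(\<lambda>t. (- 1) * y t * (1 / f t)\<^sup>2) \<in> function_algebra H"
      "(\<lambda>t. (1 - (y t)\<^sup>2 + y t * z t) * (1 / f t)) \<in> function_algebra H"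
      "(\<lambda>t. (2 - 2 * (y t)\<^sup>2 + 3 * (y t * z t)) * (1 / f t)) \<in> function_algebra H"
      "(\<lambda>t. z t * (1 / f t)) \<in> function_algebra H"
      by (intro function_algebra_intros H_base)+
    ultimately show ?thesis
      using that f y z u H_base(3) unfolding H_def[symmetric]
      by (simp only: H_def insert_iff empty_iff) (elim disjE; fastforce)
  qed
  have shell: "shell {0..1} \<subseteq> shell J" using J by (auto simp: shell_def)
  have "riemannian_metric {0..1} (warped_metric f)"
    unfolding riemannian_metric_def
  proof (intro conjI ballI allI)
    fix q :: point assume "q \<in> S2 \<times> {0..1}"
    then have "snd q \<in> J" using J by auto
    from pos[OF this] show "inner_product_on (tangent q) (warped_metric f q)"
      by (auto simp: inner_product_on_def warped_metric_def case_prod_unfold inner_commute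
          inner_add_left algebra_simps prod_eq_iff add_pos_nonneg add_nonneg_pos
          not_square_less_zero simp flip: power2_eq_square)
  next
    fix i j :: 3
    let ?a = "\<lambda>x. (f (ln (norm x)))\<^sup>2 * inv_sq x * of_bool (i = j)
      + (1 - (f (ln (norm x)))\<^sup>2) * (inv_sq x)\<^sup>2 * (x $ i * x $ j)"
    show "smooth_on (shell {0..1}) (\<lambda>x. metric_in_chart (warped_metric f) x $ i $ j)"
    proof (rule smooth_on_radial[OF J(1) shell H])
      show "?a \<in> function_algebra (radial_generators H)"
        by (intro function_algebra_intros radial_intros H_base)
      show "?a x = metric_in_chart (warped_metric f) x $ i $ j" if "x \<in> shell {0..1}" for x
        using that by (simp add: metric_in_chart_warped shell_def)
    qed
  qed
  moreover have "smooth_function {0..1} (\<lambda>q. u (snd q))"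
    unfolding smooth_function_def
    by (rule smooth_on_radial[OF J(1) shell H radial_in_function_algebra[OF H_base(5)]])
      (auto simp: chart_def)
  moreover have "invariant_metric {0..1} (warped_metric f)"
    by (auto simp: invariant_metric_def warped_metric_def SO3_inner)
  moreover have "invariant_function {0..1} (\<lambda>q. u (snd q))"
    by (simp add: invariant_function_def)
  moreover have "normal_form 1 {0..1} (warped_metric f)"
    by (auto simp: normal_form_def warped_metric_def slice_def)
  moreover have "quasi_einstein 0 0 {0<..<1} (warped_metric f) (\<lambda>q. u (snd q))"
  proof (rule quasi_einstein_warped)
    fix t :: real assume "t \<in> {0<..<1}"
    then have t: "t \<in> J" using J by auto
    have nz: "f t \<noteq> 0" using pos[OF t] by simp
    show "f t > 0" by (rule pos[OF t])
    show "(f has_real_derivative y t) (at t)" by (rule f[OF t])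
    show "(y has_real_derivative (1 - (y t)\<^sup>2 + y t * z t) / f t) (at t)" by (rule y[OF t])
    show "(u has_real_derivative z t / f t) (at t)" by (rule u[OF t])
    show "((\<lambda>t. z t / f t) has_real_derivative
        ((2 - 2 * (y t)\<^sup>2 + 3 * (y t * z t)) / f t * f t - z t * y t) / (f t * f t)) (at t)"
      by (rule DERIV_divide[OF z[OF t] f[OF t] nz])
    \<comment> \<open>The left side is the quotient rule for u' = z/f; subtracting y z leaves twice
      the numerator of y' = f''.\<close>
    show "((2 - 2 * (y t)\<^sup>2 + 3 * (y t * z t)) / f t * f t - z t * y t) / (f t * f t)
        = 2 * ((1 - (y t)\<^sup>2 + y t * z t) / f t / f t)"
      using nz by (simp add: divide_simps)
    show "1 - (y t)\<^sup>2 - f t * ((1 - (y t)\<^sup>2 + y t * z t) / f t) + f t * y t * (z t / f t) = 0"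
      using nz by simp
  qed simp
  ultimately show ?thesis
    by (simp add: dirichlet_quasi_einstein_def slice_def warped_metric_def bc)
qed

theorem theorem5p2:
  shows "\<exists>\<gamma>. riemannian_metric_S2 \<gamma> \<and> invariant_metric_S2 \<gamma> \<and>
    (\<exists>g1 u1 g2 u2.
       dirichlet_quasi_einstein 0 0 1 \<gamma> g1 u1 \<and>
       dirichlet_quasi_einstein 0 0 1 \<gamma> g2 u2 \<and>
       \<not> same_pair {0<..<1} (g1, u1) (g2, u2))"
proof -
  obtain T :: real and F y z u :: "real \<Rightarrow> real" and x1 x2 where
    F_pos: "\<And>x. \<bar>x\<bar> < T \<Longrightarrow> F x > 0"
    and F: "\<And>x. \<bar>x\<bar> < T \<Longrightarrow> (F has_real_derivative y x) (at x)"
    and y: "\<And>x. \<bar>x\<bar> < T \<Longrightarrow> (y has_real_derivative (1 - (y x)\<^sup>2 + y x * z x) / F x) (at x)"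
    and z: "\<And>x. \<bar>x\<bar> < T \<Longrightarrow> (z has_real_derivative (2 - 2 * (y x)\<^sup>2 + 3 * (y x * z x)) / F x) (at x)"
    and u: "\<And>x. \<bar>x\<bar> < T \<Longrightarrow> (u has_real_derivative z x / F x) (at x)"
    and even: "\<And>x. \<bar>x\<bar> < T \<Longrightarrow> F (- x) = F x" "\<And>x. \<bar>x\<bar> < T \<Longrightarrow> u (- x) = u x"
    and F0: "F 0 = 1" and x12: "0 < x1" "x1 < x2" "x2 < T" "F x1 = 6 * x1" "F x2 = 6 * x2"
    using soliton_profile by blast
  \<comment> \<open>\<open>\<phi> a\<close> maps [0,1] onto [-a,a]. Dividing \<open>F\<close> by its
    speed 2a restores the coefficient 1 of dt^2, and \<open>F a = 6 * a\<close> gives boundary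
    radius 3. Subtracting \<open>u a\<close> leaves the equation unchanged; evenness makes the data
    at both ends agree.\<close>
  define \<phi> where "\<phi> a t = a * (2 * t - 1)" for a t :: real
  define f where "f a t = F (\<phi> a t) / (2 * a)" for a t
  define v where "v a t = u (\<phi> a t) - u a" for a t
  have solution: "dirichlet_quasi_einstein 0 0 1 (\<lambda>p v w. 3\<^sup>2 * (v \<bullet> w))
      (warped_metric (f a)) (\<lambda>q. v a (snd q))" if a: "0 < a" "a < T" "F a = 6 * a" for a
  proof (rule dirichlet_quasi_einstein_warped)
    show "open {t. \<bar>\<phi> a t\<bar> < T}"
      unfolding \<phi>_def by (intro open_Collect_less continuous_intros)
    show "{0..1} \<subseteq> {t. \<bar>\<phi> a t\<bar> < T}"
    proof
      fix t :: real assume "t \<in> {0..1}"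
      then have "\<bar>2 * t - 1\<bar> \<le> 1" by auto
      then have "\<bar>\<phi> a t\<bar> \<le> a" using a by (simp add: \<phi>_def abs_mult mult_left_le)
      then show "t \<in> {t. \<bar>\<phi> a t\<bar> < T}" using a by simp
    qed
    show "f a 0 = 3" "f a 1 = 3" "v a 0 = 0" "v a 1 = 0"
      using a even[of a] by (simp_all add: f_def v_def \<phi>_def)
    fix t assume "t \<in> {t. \<bar>\<phi> a t\<bar> < T}"
    then have t: "\<bar>\<phi> a t\<bar> < T" by simp
    have \<phi>: "(\<phi> a has_real_derivative 2 * a) (at t)"
      unfolding \<phi>_def by (auto intro!: derivative_eq_intros)
    show "f a t > 0" using F_pos[OF t] a by (simp add: f_def)
    show "(f a has_real_derivative y (\<phi> a t)) (at t)"
      unfolding f_def using DERIV_cdivide[OF DERIV_chain2[OF F[OF t] \<phi>], of "2 * a"] a by simp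
    show "((\<lambda>t. y (\<phi> a t)) has_real_derivative
        (1 - (y (\<phi> a t))\<^sup>2 + y (\<phi> a t) * z (\<phi> a t)) / f a t) (at t)"
      using DERIV_chain2[OF y[OF t] \<phi>] by (simp add: f_def)
    show "((\<lambda>t. z (\<phi> a t)) has_real_derivative
        (2 - 2 * (y (\<phi> a t))\<^sup>2 + 3 * (y (\<phi> a t) * z (\<phi> a t))) / f a t) (at t)"
      using DERIV_chain2[OF z[OF t] \<phi>] by (simp add: f_def)
    show "(v a has_real_derivative z (\<phi> a t) / f a t) (at t)"
      unfolding v_def
      using DERIV_diff[OF DERIV_chain2[OF u[OF t] \<phi>] DERIV_const[of "u a"]] by (simp add: f_def)
  qed
  have "\<not> same_pair {0<..<1} (warped_metric (f x1), \<lambda>q. v x1 (snd q))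
      (warped_metric (f x2), \<lambda>q. v x2 (snd q))"
  proof
    \<comment> \<open>At the middle slice t = 1/2 the profile is evaluated at 0, where
      \<open>F 0 = 1\<close>; the radii there are 1/(2 x1) and 1/(2 x2).\<close>
    let ?q = "(axis 1 1, 1 / 2) :: point" and ?w = "(axis 2 1, 0) :: point"
    assume "same_pair {0<..<1} (warped_metric (f x1), \<lambda>q. v x1 (snd q))
      (warped_metric (f x2), \<lambda>q. v x2 (snd q))"
    moreover have "?q \<in> S2 \<times> {0<..<1}" "?w \<in> tangent ?q"
      by (auto simp: S2_def tangent_def tangent_S2_def inner_axis_axis)
    ultimately have "warped_metric (f x1) ?q ?w ?w = warped_metric (f x2) ?q ?w ?w"
      by (auto simp: same_pair_def)
    then have "(1 / (2 * x1))\<^sup>2 = (1 / (2 * x2))\<^sup>2"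
      by (simp add: warped_metric_def f_def \<phi>_def F0 inner_axis_axis)
    then have "1 / (2 * x1) = 1 / (2 * x2)"
      by (rule power2_eq_imp_eq) (use x12 in auto)
    then show False using x12 by simp
  qed
  moreover have "riemannian_metric_S2 (\<lambda>p v w. 3\<^sup>2 * (v \<bullet> w))"
    by (rule riemannian_metric_S2_round) simp
  moreover have "invariant_metric_S2 (\<lambda>p v w. 3\<^sup>2 * (v \<bullet> w))"
    by (simp add: invariant_metric_S2_def SO3_inner)
  ultimately show ?thesis
    using solution[of x1] solution[of x2] x12 less_trans[OF x12(2,3)] less_trans[OF x12(1,2)] by blast
qed

end
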